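(* Let $p\ge1$, $\beta_0\in\mathbb R^p$, let $X$ be a random vector in $\mathbb R^p$ with Lebesgue density $f^X$ such that $\mathbb P(\|X\|\le B)=1$ for some $B>0$ and $\mathbb P(v^\top X=0)=0$ for every $v\ne0$. Let $\epsilon$ be independent of $X$ with density $f(t)=c_\alpha\exp(-d^{-\alpha}|t|^\alpha)$, where $\alpha\ge1$ is an integer, $d>0$, $c_\alpha=\frac{\alpha}{2d\Gamma(1/\alpha)}$, and let $Y=\beta_0^\top X+\epsilon$ with density $f^Y(y)=\int f(y-\beta_0^\top x)f^X(x)dx$. Let $\tilde X_1,\dots,\tilde X_n$ be i.i.d. copies of $X$ and $\tilde Y_1,\dots,\tilde Y_n$ i.i.d. copies of $Y$, the two samples independent, with $n\to\infty$ (and $m\to\infty$ with $m/n\to\lambda\in(0,1)$). Define $$\psi(x)=-\int\frac{\int zf'(y-\beta_0^\top z)f^X(z)dz}{f^Y(y)}\,f(y-\beta_0^\top x)\,dy.$$ Then $$\frac1n\sum_{j=1}^n\frac{\frac1n\sum_{i=1}^n\tilde X_if'(\tilde Y_j-\beta_0^\top\tilde X_i)}{\frac1n\sum_{i=1}^nf(\tilde Y_j-\beta_0^\top\tilde X_i)}=\frac1n\sum_{j=1}^n\frac{\int xf'(\tilde Y_j-\beta_0^\top x)f^X(x)dx}{f^Y(\tilde Y_j)}+\Big(\frac1n\sum_{i=1}^n\psi(\tilde X_i)-\mathbb E\psi(X)\Big)+o_{\mathbb P}\big(n^{-1/2}\big).$$ Furthermore, as $n\to\infty$, $$\sqrt n\,\frac1n\sum_{j=1}^n\frac{\int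 xf'(\tilde Y_j-\beta_0^\top x)f^X(x)dx}{f^Y(\tilde Y_j)}\to_dW_1,\qquad \sqrt n\Big(\frac1n\sum_{i=1}^n\psi(\tilde X_i)-\mathbb E\psi(X)\Big)\to_dW_2,$$ where $W_1,W_2$ are independent centered Gaussian vectors in $\mathbb R^p$ with covariance matrices $$\Gamma_1=\int\frac{\big(\int xf'(y-\beta_0^\top x)f^X(x)dx\big)\big(\int x^\top f'(y-\beta_0^\top x)f^X(x)dx\big)}{f^Y(y)}\,dy,$$ $$\Gamma_2=\int\Big(\int\frac{f(y-\beta_0^\top x)\int zf'(y-\beta_0^\top z)f^X(z)dz}{f^Y(y)}dy\Big)\Big(\int\frac{f(y-\beta_0^\top x)\int z^\top f'(y-\beta_0^\top z)f^X(z)dz}{f^Y(y)}dy\Big)f^X(x)\,dx$$ respectively.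
   Context: $f'$ is the derivative of $f$ (existing except possibly at $0$ when $\alpha=1$). Here $\tilde X_i$ and $\tilde Y_j$ form the unmatched sample of a linear regression model $Y=\beta_0^\top X+\epsilon$; $o_{\mathbb P}$ refers to the joint law of the two samples. *)

theory Defs
  imports "HOL-Probability.Probability"
begin

definition c_alpha :: "nat \<Rightarrow> real \<Rightarrow> real" where
  "c_alpha \<alpha> d = real \<alpha> / (2 * d * Gamma (1 / real \<alpha>))"

definition dens :: "nat \<Rightarrow> real \<Rightarrow> real \<Rightarrow> real" where
  "dens \<alpha> d t = c_alpha \<alpha> d * exp (- (d powr (- real \<alpha>)) * \<bar>t\<bar> ^ \<alpha>)"

(* f' : the derivative of f (at 0 with alpha = 1 it is an unspecified value) *)
definition ddens :: "nat \<Rightarrow> real \<Rightarrow> real \<Rightarrow> real" where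
  "ddens \<alpha> d t = deriv (dens \<alpha> d) t"

definition densY :: "nat \<Rightarrow> real \<Rightarrow> ('a::euclidean_space) \<Rightarrow> ('a \<Rightarrow> real) \<Rightarrow> real \<Rightarrow> real" where
  "densY \<alpha> d \<beta> fX y = (\<integral>x. dens \<alpha> d (y - \<beta> \<bullet> x) * fX x \<partial>lborel)"

definition Avec :: "nat \<Rightarrow> real \<Rightarrow> ('a::euclidean_space) \<Rightarrow> ('a \<Rightarrow> real) \<Rightarrow> real \<Rightarrow> 'a" where
  "Avec \<alpha> d \<beta> fX y = (\<integral>z. (ddens \<alpha> d (y - \<beta> \<bullet> z) * fX z) *\<^sub>R z \<partial>lborel)"

definition psi :: "nat \<Rightarrow> real \<Rightarrow> ('a::euclidean_space) \<Rightarrow> ('a \<Rightarrow> real) \<Rightarrow> 'a \<Rightarrow> 'a" where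
  "psi \<alpha> d \<beta> fX x =
     - (\<integral>y. (dens \<alpha> d (y - \<beta> \<bullet> x) / densY \<alpha> d \<beta> fX y) *\<^sub>R Avec \<alpha> d \<beta> fX y \<partial>lborel)"

definition Bvec :: "nat \<Rightarrow> real \<Rightarrow> ('a::euclidean_space) \<Rightarrow> ('a \<Rightarrow> real) \<Rightarrow> 'a \<Rightarrow> 'a" where
  "Bvec \<alpha> d \<beta> fX x =
     (\<integral>y. (dens \<alpha> d (y - \<beta> \<bullet> x) / densY \<alpha> d \<beta> fX y) *\<^sub>R Avec \<alpha> d \<beta> fX y \<partial>lborel)"

definition outer :: "real^'n \<Rightarrow> real^'n \<Rightarrow> real^'n^'n" where
  "outer a b = (\<chi> i j. a $ i * b $ j)"

definition Gamma1 :: "nat \<Rightarrow> real \<Rightarrow> real^'n \<Rightarrow> (real^'n \<Rightarrow> real) \<Rightarrow> real^'n^'n" where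
  "Gamma1 \<alpha> d \<beta> fX =
     (\<integral>y. (1 / densY \<alpha> d \<beta> fX y) *\<^sub>R outer (Avec \<alpha> d \<beta> fX y) (Avec \<alpha> d \<beta> fX y) \<partial>lborel)"

definition Gamma2 :: "nat \<Rightarrow> real \<Rightarrow> real^'n \<Rightarrow> (real^'n \<Rightarrow> real) \<Rightarrow> real^'n^'n" where
  "Gamma2 \<alpha> d \<beta> fX =
     (\<integral>x. fX x *\<^sub>R outer (Bvec \<alpha> d \<beta> fX x) (Bvec \<alpha> d \<beta> fX x) \<partial>lborel)"

definition centered_gaussian :: "(real^'n) measure \<Rightarrow> real^'n^'n \<Rightarrow> bool" where
  "centered_gaussian \<mu> G \<longleftrightarrow> prob_space \<mu> \<and> sets \<mu> = sets borel \<and>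
     (\<forall>t. (\<integral>x. cis (t \<bullet> x) \<partial>\<mu>) = complex_of_real (exp (- (t \<bullet> (G *v t)) / 2)))"

definition conv_in_distr :: "(nat \<Rightarrow> ('a::topological_space) measure) \<Rightarrow> 'a measure \<Rightarrow> bool" where
  "conv_in_distr \<mu>s \<mu> \<longleftrightarrow>
     (\<forall>g::'a \<Rightarrow> real. continuous_on UNIV g \<and> bounded (range g) \<longrightarrow>
        (\<lambda>n. \<integral>x. g x \<partial>(\<mu>s n)) \<longlonglongrightarrow> (\<integral>x. g x \<partial>\<mu>))"

end

theory Submission
  imports Defs "HOL-Real_Asymp.Real_Asymp"
begin

text \<open>Write \<open>r = A / f\<^sup>Y\<close> and, for the empirical denominator \<open>D\<^sub>n(y)\<close> and the empirical ratio \<open>r\<^sub>n(y)\<close>,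
  \[ r_n - r = \frac1n \sum_i \frac{h(X_i, y)}{f^Y(y)} + (r_n - r) \frac{f^Y - D_n}{f^Y}, \qquad
     h(x, y) = x f'(y - \beta_0^\top x) - r(y) f(y - \beta_0^\top x). \]
  Averaged over \<open>Y\<^sub>j\<close>, the first term is the average of \<open>\<psi>(X\<^sub>i)\<close> plus a two-sample U-statistic that is degenerate in
  both arguments, hence of root mean square order \<open>1/n\<close>. Since \<open>f\<^sup>Y\<close> is also the density of \<open>Y\<close>, it cancels in
  the mean of the second term, which is at most the integral over \<open>y\<close> of the mean of
  \<open>\<bar>r\<^sub>n - r\<bar> \<bar>f\<^sup>Y - D\<^sub>n\<bar>\<close>. By Cauchy-Schwarz, \<open>sqrt n\<close> times this mean is pointwise small and dominated by an
  integrable function of \<open>y\<close>, so no rate for \<open>r\<^sub>n\<close> that is uniform in \<open>y\<close> is needed. The limit laws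
  follow from the central limit theorem on the line and convergence of characteristic functions.\<close>

section \<open>Weak convergence from characteristic functions\<close>

text \<open>The obstacle is the tail in y, where D_n and f^Y both decay and their relative error has
  no evident uniform control. What survives there is a bound on the ratios that ignores the size of
  the denominator: if |H| \<le> q k pointwise, then r and r_n, being averages of H / k with positive
  weights, are bounded by q. For this density f' / f grows only polynomially while f decays at least
  exponentially, so q can have a small exponential rate and q^2 G stays integrable, G being an upper
  envelope of the kernel. A positive lower envelope m enters at fixed y only, to make the error at
  that y tend to zero. Degeneracy in y rests on f' having integral zero over the line: this
  identifies \<psi>(x) as the mean of h(x, Y) / f^Y(Y). The same fact gives mean zero for \<psi>(X),
  so the centering in the statement subtracts zero. Both limits are obtained from one joint limit on
  the product space, where the characteristic functions factor because the samples are independent;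
  the separate limits are its marginals.\<close>

inductive trig_poly :: "('a::real_inner \<Rightarrow> complex) \<Rightarrow> bool" where
  cis: "trig_poly (\<lambda>x. c * cis (t \<bullet> x))"
| add: "trig_poly f \<Longrightarrow> trig_poly g \<Longrightarrow> trig_poly (\<lambda>x. f x + g x)"

lemma trig_poly_const: "trig_poly (\<lambda>x. c)"
  using trig_poly.cis[of c 0] by simp

lemma trig_poly_cmult: "trig_poly f \<Longrightarrow> trig_poly (\<lambda>x. c * cis (t \<bullet> x) * f x)"
proof (induction rule: trig_poly.induct)
  case (cis c' t')
  have "trig_poly (\<lambda>x. (c * c') * cis ((t + t') \<bullet> x))" by (rule trig_poly.cis)
  then show ?case by (simp add: inner_add_left cis_mult[symmetric] mult_ac)
next
  case (add f g)
  then show ?case using trig_poly.add by (fastforce simp: distrib_left)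
qed

text \<open>Products of characters are characters, so their combinations form an algebra. Closure
  under products is what allows a polynomial in \<open>sin_clip\<close> to be integrated through
  characteristic functions alone.\<close>

lemma trig_poly_mult: "trig_poly f \<Longrightarrow> trig_poly g \<Longrightarrow> trig_poly (\<lambda>x. f x * g x)"
proof (induction rule: trig_poly.induct)
  case (cis c t)
  then show ?case by (rule trig_poly_cmult)
next
  case (add f f')
  then show ?case using trig_poly.add by (fastforce simp: distrib_right)
qed

lemma trig_poly_sum: "finite I \<Longrightarrow> (\<And>i. i \<in> I \<Longrightarrow> trig_poly (f i)) \<Longrightarrow> trig_poly (\<lambda>x. \<Sum>i\<in>I. f i x)"
  by (induction rule: finite_induct) (auto intro: trig_poly_const trig_poly.add)

lemma trig_poly_sin: "trig_poly (\<lambda>x. complex_of_real (c * sin (t \<bullet> x)))"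
proof -
  have "trig_poly (\<lambda>x. (complex_of_real c / (2 * \<i>)) * cis (t \<bullet> x) + (- complex_of_real c / (2 * \<i>)) * cis ((- t) \<bullet> x))"
    by (intro trig_poly.intros)
  also have "(\<lambda>x. (complex_of_real c / (2 * \<i>)) * cis (t \<bullet> x) + (- complex_of_real c / (2 * \<i>)) * cis ((- t) \<bullet> x)) =
     (\<lambda>x. complex_of_real (c * sin (t \<bullet> x)))"
    by (auto simp: complex_eq_iff fun_eq_iff Re_divide Im_divide power2_eq_square)
  finally show ?thesis .
qed

text \<open>A bounded stand-in for the identity that stays within trigonometric polynomials: each
  coordinate is a sine of a linear functional, and for large \<open>L\<close> it is close to the
  coordinate itself on any fixed ball. A truncation to a box would have bounded range but not this
  form.\<close>

definition sin_clip :: "real \<Rightarrow> 'a::euclidean_space \<Rightarrow> 'a" where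
  "sin_clip L x = (\<Sum>b\<in>Basis. (L * sin ((x \<bullet> b) / L)) *\<^sub>R b)"

lemma trig_poly_sin_clip:
  "real_polynomial_function p \<Longrightarrow> trig_poly (\<lambda>x. complex_of_real (p (sin_clip L x)))"
proof (induction rule: real_polynomial_function.induct)
  case (linear f)
  interpret bounded_linear f by fact
  have "trig_poly (\<lambda>x::'a. \<Sum>b\<in>Basis. complex_of_real ((L * f b) * sin ((b /\<^sub>R L) \<bullet> x)))"
    by (intro trig_poly_sum trig_poly_sin) auto
  also have "(\<lambda>x::'a. \<Sum>b\<in>Basis. complex_of_real ((L * f b) * sin ((b /\<^sub>R L) \<bullet> x))) = (\<lambda>x. complex_of_real (f (sin_clip L x)))"
    by (auto simp: sin_clip_def sum scaleR inner_commute divide_inverse mult_ac fun_eq_iff intro!: sum.cong)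
  finally show ?case .
qed (auto intro: trig_poly_const trig_poly.add trig_poly_mult)

lemma norm_sin_clip_le: "(L::real) > 0 \<Longrightarrow> norm (sin_clip L (x::'a::euclidean_space)) \<le> real DIM('a) * L"
  unfolding sin_clip_def
  by (rule order.trans[OF norm_sum], rule order.trans[OF sum_bounded_above[where K=L]])
     (auto simp: abs_mult mult_le_cancel_left1)

lemma abs_sin_diff_le: "\<bar>sin u - u\<bar> \<le> u\<^sup>2" for u :: real
proof -
  have "\<bar>sin u - u\<bar> \<le> u\<^sup>2 / 2"
    using Maclaurin_sin_bound[of u 2] by (simp add: eval_nat_numeral sin_coeff_def field_simps abs_mult)
  then show ?thesis by (smt (verit) zero_le_power2 field_sum_of_halves)
qed

text \<open>With \<open>u = (x \<bullet> b) / L\<close>, each coordinate errs by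
  \<open>L * \<bar>sin u - u\<bar>\<close>, at most
  \<open>L * u\<^sup>2 = (x \<bullet> b)\<^sup>2 / L\<close>, so the error on a fixed ball is of
  order 1 / L.\<close>

lemma norm_sin_clip_diff_le:
  assumes "L > 0" shows "norm (sin_clip L (x::'a::euclidean_space) - x) \<le> DIM('a) * ((norm x)\<^sup>2 / L)"
proof -
  have "sin_clip L x - x = (\<Sum>b\<in>Basis. (L * sin ((x \<bullet> b) / L) - x \<bullet> b) *\<^sub>R b)"
    by (subst (2) euclidean_representation[symmetric, of x])
       (simp add: sin_clip_def sum_subtractf scaleR_left_diff_distrib)
  also have "norm \<dots> \<le> (\<Sum>b\<in>(Basis::'a set). (norm x)\<^sup>2 / L)"
  proof (rule sum_norm_le)
    fix b :: 'a assume b: "b \<in> Basis"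
    define u where "u = (x \<bullet> b) / L"
    have "norm ((L * sin ((x \<bullet> b) / L) - x \<bullet> b) *\<^sub>R b) = \<bar>L * (sin u - u)\<bar>"
      using b assms by (simp add: u_def right_diff_distrib)
    also have "\<dots> \<le> L * u\<^sup>2" using abs_sin_diff_le[of u] assms by (simp add: abs_mult)
    also have "\<dots> = (x \<bullet> b)\<^sup>2 / L" using assms by (simp add: u_def power2_eq_square)
    also have "\<dots> \<le> (norm x)\<^sup>2 / L"
      using Basis_le_norm[OF b, of x] assms by (intro divide_right_mono) (auto simp: abs_le_square_iff[symmetric])
    finally show "norm ((L * sin ((x \<bullet> b) / L) - x \<bullet> b) *\<^sub>R b) \<le> (norm x)\<^sup>2 / L" .
  qed
  finally show ?thesis by simp
qed

lemma borel_measurable_cis [measurable]: "cis \<in> borel_measurable borel"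
  by (intro borel_measurable_continuous_onI continuous_on_cis continuous_on_id)

lemma (in prob_space) integrable_cis:
  assumes [measurable]: "f \<in> borel_measurable M"
  shows "integrable M (\<lambda>x. cis (f x))"
  by (rule integrable_const_bound[where B=1]) simp_all

lemma trig_poly_integrable:
  assumes "trig_poly f" "prob_space M" "sets M = sets (borel :: 'a::euclidean_space measure)"
  shows "integrable M f"
  using assms(1)
proof induction
  case (cis c t)
  interpret prob_space M by fact
  note [measurable_cong] = assms(3)
  show ?case by (intro integrable_mult_right integrable_cis) measurable
qed auto

lemma trig_poly_converges:
  assumes "trig_poly f" and \<mu>s: "\<And>n. prob_space (\<mu>s n)" "\<And>n. sets (\<mu>s n) = sets (borel :: 'a::euclidean_space measure)"
    and \<mu>: "prob_space \<mu>" "sets \<mu> = sets borel"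
    and cf: "\<And>t. (\<lambda>n. \<integral>x. cis (t \<bullet> x) \<partial>\<mu>s n) \<longlonglongrightarrow> (\<integral>x. cis (t \<bullet> x) \<partial>\<mu>)"
  shows "(\<lambda>n. \<integral>x. f x \<partial>\<mu>s n) \<longlonglongrightarrow> (\<integral>x. f x \<partial>\<mu>)"
  using assms(1)
proof induction
  case (cis c t)
  show ?case using tendsto_mult_left[OF cf] by simp
next
  case (add f g)
  have "integrable (\<mu>s n) f" "integrable (\<mu>s n) g" "integrable \<mu> f" "integrable \<mu> g" for n
    using add \<mu>s \<mu> trig_poly_integrable by blast+
  with add show ?case by (simp add: tendsto_add)
qed

text \<open>On the ball the integrands differ by at most \<open>e\<close>; off it by at most
  \<open>2 * G + 1\<close>, which the tail bound turns into another \<open>e\<close>. The bound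
  \<open>G + 1\<close> for \<open>h\<close> leaves room for an approximation of \<open>g\<close>
  with error below 1.\<close>

lemma bounded_tail_integral_diff_le:
  assumes "prob_space \<nu>" and sets: "sets \<nu> = sets (borel :: 'a::euclidean_space measure)"
    and [measurable]: "g \<in> borel_measurable borel" "h \<in> borel_measurable borel"
    and gG: "\<And>x. \<bar>g x\<bar> \<le> G" and hG: "\<And>x. \<bar>h x\<bar> \<le> G + 1"
    and near: "\<And>x. norm x \<le> R \<Longrightarrow> \<bar>g x - h x\<bar> \<le> e"
    and tail: "measure \<nu> {x. norm x > R} \<le> e / (2 * G + 1)" and G: "G \<ge> 0" and e: "e > 0"
  shows "\<bar>(\<integral>x. g x \<partial>\<nu>) - (\<integral>x. h x \<partial>\<nu>)\<bar> \<le> 2 * e"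
proof -
  interpret prob_space \<nu> by fact
  note [measurable_cong] = sets
  have sp: "space \<nu> = UNIV" using sets_eq_imp_space_eq[OF sets] by simp
  have int: "integrable \<nu> g" "integrable \<nu> h"
    by (rule integrable_const_bound[where B=G], use gG in auto)
       (rule integrable_const_bound[where B="G + 1"], use hG in auto)
  have "\<bar>(\<integral>x. g x \<partial>\<nu>) - (\<integral>x. h x \<partial>\<nu>)\<bar> = \<bar>\<integral>x. g x - h x \<partial>\<nu>\<bar>" using int by simp
  also have "\<dots> \<le> (\<integral>x. \<bar>g x - h x\<bar> \<partial>\<nu>)" by (rule integral_abs_bound)
  also have "\<dots> \<le> (\<integral>x. e + (2 * G + 1) * indicator {x. norm x > R} x \<partial>\<nu>)"
  proof (rule integral_mono)
    show "integrable \<nu> (\<lambda>x. e + (2 * G + 1) * indicator {x. norm x > R} x)"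
      by (intro integrable_const_bound[where B="e + (2 * G + 1)"]) (use G e in \<open>auto simp: indicator_def\<close>)
    fix x show "\<bar>g x - h x\<bar> \<le> e + (2 * G + 1) * indicator {x. norm x > R} x"
      using near[of x] gG[of x] hG[of x] e by (cases "norm x \<le> R") (auto simp: indicator_def)
  qed (use int in auto)
  also have "\<dots> = e + (2 * G + 1) * measure \<nu> {x. norm x > R}"
  proof -
    have *: "{x. norm x > R} \<in> sets \<nu>" unfolding sets by measurable
    then have "(\<integral>x. e + (2 * G + 1) * indicator {x. norm x > R} x \<partial>\<nu>)
      = (\<integral>x. e \<partial>\<nu>) + (2 * G + 1) * (\<integral>x. indicator {x. norm x > R} x \<partial>\<nu>)"
      by (subst Bochner_Integration.integral_add)
         (auto intro!: integrable_real_indicator simp: emeasure_eq_measure)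
    then show ?thesis using prob_space by (simp add: sp)
  qed
  also have "\<dots> \<le> e + (2 * G + 1) * (e / (2 * G + 1))" using tail G by (intro add_left_mono mult_left_mono) auto
  also have "\<dots> = 2 * e" using G by simp
  finally show ?thesis .
qed

lemma prob_space_tight:
  assumes "prob_space \<nu>" and sets: "sets \<nu> = sets (borel :: 'a::euclidean_space measure)" and "e > 0"
  shows "\<exists>R. measure \<nu> {x. norm x > R} \<le> e"
proof -
  interpret prob_space \<nu> by fact
  have "(\<lambda>n. measure \<nu> {x. norm x > real n}) \<longlonglongrightarrow> measure \<nu> (\<Inter>n. {x. norm x > real n})"
    by (intro finite_Lim_measure_decseq) (auto simp: decseq_def sets)
  also have "(\<Inter>n. {x::'a. norm x > real n}) = {}"
    by (auto simp: not_less) (meson real_arch_simple not_less)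
  finally have "(\<lambda>n. measure \<nu> {x. norm x > real n}) \<longlonglongrightarrow> 0" by simp
  from order_tendstoD(2)[OF this \<open>e > 0\<close>] show ?thesis
    by (auto simp: eventually_sequentially intro: less_imp_le)
qed

text \<open>A tight sequence only sees a bounded continuous \<open>g\<close> on a ball, where \<open>g\<close> is close to
  \<open>g \<circ> sin_clip L\<close> for large \<open>L\<close>. The latter is a uniform limit of trigonometric polynomials on the
  whole space, because \<open>sin_clip L\<close> has a bounded range on which polynomials approximate \<open>g\<close>.\<close>

theorem conv_in_distr_of_char:
  fixes \<mu> :: "'a::euclidean_space measure"
  assumes \<mu>s: "\<And>n. prob_space (\<mu>s n)" "\<And>n. sets (\<mu>s n) = sets borel"
    and \<mu>: "prob_space \<mu>" "sets \<mu> = sets borel"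
    and cf: "\<And>t. (\<lambda>n. \<integral>x. cis (t \<bullet> x) \<partial>\<mu>s n) \<longlonglongrightarrow> (\<integral>x. cis (t \<bullet> x) \<partial>\<mu>)"
    and tight: "\<And>e. e > 0 \<Longrightarrow> \<exists>R. \<forall>n. measure (\<mu>s n) {x. norm x > R} \<le> e"
  shows "conv_in_distr \<mu>s \<mu>"
  unfolding conv_in_distr_def
proof (intro allI impI)
  fix g :: "'a \<Rightarrow> real" assume g: "continuous_on UNIV g \<and> bounded (range g)"
  then obtain G where G: "\<And>x. \<bar>g x\<bar> \<le> G" "G > 0"
    unfolding bounded_pos by force
  have gm [measurable]: "g \<in> borel_measurable borel" using g by (intro borel_measurable_continuous_onI) auto
  show "(\<lambda>n. \<integral>x. g x \<partial>\<mu>s n) \<longlonglongrightarrow> (\<integral>x. g x \<partial>\<mu>)"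
  proof (rule LIMSEQ_I)
    fix r :: real assume r: "r > 0"
    \<comment> \<open>The budget is \<open>2 * e\<close> for replacing \<open>g\<close> by
      \<open>h\<close> under \<open>\<mu>s n\<close>, \<open>e\<close> for the convergence of the
      integrals of \<open>h\<close>, and \<open>2 * e\<close> for going back under
      \<open>\<mu>\<close>. The bound \<open>e \<le> 1\<close> gives
      \<open>\<bar>h x\<bar> \<le> G + 1\<close>.\<close>
    define e where "e = min 1 (r / 10)"
    have e: "e > 0" "e \<le> 1" "5 * e < r" using r by (auto simp: e_def min_def)
    define e2 where "e2 = e / (2 * G + 1)"
    have e2: "e2 > 0" using e G by (auto simp: e2_def)
    obtain R1 where R1: "\<And>n. measure (\<mu>s n) {x. norm x > R1} \<le> e2" using tight[OF e2] by auto
    obtain R2 where R2: "measure \<mu> {x. norm x > R2} \<le> e2" using prob_space_tight[OF \<mu> e2] by auto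
    define R where "R = max 1 (max R1 R2)"
    have R: "R \<ge> 1" "R \<ge> R1" "R \<ge> R2" by (auto simp: R_def)
    have tail: "measure \<nu> {x. norm x > R} \<le> e2"
      if "prob_space \<nu>" "sets \<nu> = sets borel" "measure \<nu> {x. norm x > R'} \<le> e2" "R \<ge> R'" for \<nu> :: "'a measure" and R'
    proof -
      interpret prob_space \<nu> by fact
      have "{x. norm x > R'} \<in> sets \<nu>" unfolding that by measurable
      then have "measure \<nu> {x. norm x > R} \<le> measure \<nu> {x. norm x > R'}"
        by (rule finite_measure_mono[rotated]) (use that in auto)
      with that show ?thesis by simp
    qed
    \<comment> \<open>Clipping can push a point of the ball of radius \<open>R\<close> outwards by
      up to \<open>\<delta>' \<le> 1\<close>, hence the radius \<open>R + 1\<close>.\<close>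
    have "uniformly_continuous_on (cball 0 (R + 1)) g"
      using g by (intro compact_uniformly_continuous) (auto intro: continuous_on_subset)
    then obtain \<delta> where \<delta>: "\<delta> > 0" "\<And>x y. norm x \<le> R + 1 \<Longrightarrow> norm y \<le> R + 1 \<Longrightarrow> dist y x < \<delta> \<Longrightarrow> dist (g y) (g x) < e/2"
      unfolding uniformly_continuous_on_def using half_gt_zero[OF e(1)] by (metis mem_cball_0)
    define \<delta>' where "\<delta>' = min (\<delta>/2) 1"
    have \<delta>': "\<delta>' > 0" "\<delta>' < \<delta>" "\<delta>' \<le> 1" using \<delta> by (auto simp: \<delta>'_def)
    \<comment> \<open>This \<open>L\<close> makes the clipping error
      \<open>DIM('a) * (R\<^sup>2 / L)\<close> equal to \<open>\<delta>'\<close>.\<close>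
    define L where "L = DIM('a) * R\<^sup>2 / \<delta>'"
    have L: "L > 0" using R \<delta>' by (auto simp: L_def)
    have clip: "norm (sin_clip L x - x) \<le> \<delta>'" if "norm x \<le> R" for x :: 'a
    proof -
      have "norm (sin_clip L x - x) \<le> DIM('a) * ((norm x)\<^sup>2 / L)" by (rule norm_sin_clip_diff_le[OF L])
      also have "\<dots> \<le> DIM('a) * (R\<^sup>2 / L)" using that L by (intro mult_left_mono divide_right_mono power_mono) auto
      also have "\<dots> = \<delta>'" using R \<delta>' by (simp add: L_def)
      finally show ?thesis .
    qed
    obtain p where p: "real_polynomial_function p" "\<And>x. x \<in> cball 0 (DIM('a) * L) \<Longrightarrow> \<bar>g x - p x\<bar> < e/2"
      using Stone_Weierstrass_real_polynomial_function[of "cball 0 (DIM('a) * L)" g "e/2"] g e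
      by (auto intro: continuous_on_subset)
    define h where "h x = p (sin_clip L x)" for x
    have gh: "\<bar>g (sin_clip L x) - h x\<bar> < e/2" for x
      unfolding h_def by (rule p) (simp add: norm_sin_clip_le[OF L] dist_norm)
    have hG: "\<bar>h x\<bar> \<le> G + 1" for x using gh[of x] G(1)[of "sin_clip L x"] e by linarith
    have near: "\<bar>g x - h x\<bar> \<le> e" if x: "norm x \<le> R" for x
    proof -
      have "norm (sin_clip L x) \<le> R + 1" using clip[OF x] x \<delta>' norm_triangle_ineq2[of "sin_clip L x" x] by linarith
      then have "dist (g (sin_clip L x)) (g x) < e/2" using clip[OF x] x \<delta>' by (intro \<delta>(2)) (auto simp: dist_norm)
      then show ?thesis using gh[of x] unfolding dist_real_def by linarith
    qed
    have htp: "trig_poly (\<lambda>x. complex_of_real (h x))" unfolding h_def by (rule trig_poly_sin_clip[OF p(1)])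
    have "continuous_on UNIV (sin_clip L :: 'a \<Rightarrow> 'a)"
      unfolding sin_clip_def[abs_def] using L by (intro continuous_intros) auto
    moreover have "continuous_on UNIV p"
      using p(1) by (simp add: continuous_on_polymonial_function real_polynomial_function_eq)
    ultimately have "continuous_on UNIV h" unfolding h_def
      using continuous_on_compose2[of UNIV p UNIV "sin_clip L"] by simp
    then have hm: "h \<in> borel_measurable borel" by (rule borel_measurable_continuous_onI)
    have conv: "(\<lambda>n. \<integral>x. h x \<partial>\<mu>s n) \<longlonglongrightarrow> (\<integral>x. h x \<partial>\<mu>)"
      using trig_poly_converges[OF htp \<mu>s \<mu> cf] unfolding integral_complex_of_real tendsto_of_real_iff .
    have b1: "\<bar>(\<integral>x. g x \<partial>\<mu>s n) - (\<integral>x. h x \<partial>\<mu>s n)\<bar> \<le> 2 * e" for n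
      by (rule bounded_tail_integral_diff_le[OF \<mu>s gm hm G(1) hG near])
         (use tail[OF \<mu>s R1] R e G in \<open>auto simp: e2_def\<close>)
    have b2: "\<bar>(\<integral>x. g x \<partial>\<mu>) - (\<integral>x. h x \<partial>\<mu>)\<bar> \<le> 2 * e"
      by (rule bounded_tail_integral_diff_le[OF \<mu> gm hm G(1) hG near])
         (use tail[OF \<mu> R2] R e G in \<open>auto simp: e2_def\<close>)
    from LIMSEQ_D[OF conv e(1)] obtain N where
      N: "\<And>n. n \<ge> N \<Longrightarrow> \<bar>(\<integral>x. h x \<partial>\<mu>s n) - (\<integral>x. h x \<partial>\<mu>)\<bar> < e" by auto
    show "\<exists>N. \<forall>n\<ge>N. norm ((\<integral>x. g x \<partial>\<mu>s n) - (\<integral>x. g x \<partial>\<mu>)) < r"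
    proof (intro exI[of _ N] allI impI)
      fix n assume "n \<ge> N"
      from N[OF this] b1[of n] b2 e(3) show "norm ((\<integral>x. g x \<partial>\<mu>s n) - (\<integral>x. g x \<partial>\<mu>)) < r"
        by simp
    qed
  qed
qed

section \<open>Gaussian measures with a given covariance form\<close>

lemma gaussian_char_scale:
  "(\<integral>z. cis (c * z) \<partial>std_normal_distribution) = complex_of_real (exp (- c\<^sup>2 / 2))"
  using fun_cong[OF char_std_normal_distribution, of c] by (simp add: char_def cis_conv_exp)

text \<open>Lagrange reduction: coordinate by coordinate, the form is split into the square of a linear
  functional (the next independent standard normal) and a form that vanishes on one more basis vector.\<close>

lemma gaussian_exists_aux:
  fixes q :: "'a::euclidean_space \<Rightarrow> 'a \<Rightarrow> real"
  assumes "finite S" "S \<subseteq> Basis" "\<And>s. linear (q s)" "\<And>s t. q s t = q t s" "\<And>t. q t t \<ge> 0"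
    and "\<And>b t. b \<in> Basis - S \<Longrightarrow> q b t = 0"
  shows "\<exists>\<mu>. prob_space \<mu> \<and> sets \<mu> = sets borel \<and>
    (\<forall>t. (\<integral>x. cis (t \<bullet> x) \<partial>\<mu>) = complex_of_real (exp (- (q t t) / 2)))"
  using assms
proof (induction S arbitrary: q rule: finite_induct)
  case empty
  have "q s t = 0" for s t
  proof -
    interpret linear "q t" by fact
    have "q t s = q t (\<Sum>b\<in>Basis. (s \<bullet> b) *\<^sub>R b)" by (simp add: euclidean_representation)
    also have "\<dots> = (\<Sum>b\<in>Basis. (s \<bullet> b) * q t b)" by (simp add: sum scaleR)
    also have "\<dots> = 0" using empty(3,5) by simp
    finally show ?thesis using empty(3) by simp
  qed
  then show ?case
    by (intro exI[of _ "return borel 0"])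
       (auto simp: prob_space_return integral_return)
next
  case (insert b S)
  note lin = insert.prems(2) and sym = insert.prems(3) and psd = insert.prems(4)
  have lin': "q s (t + t') = q s t + q s t'" "q s (c *\<^sub>R t) = c * q s t" for s t t' c
    using linear_add[OF lin] linear_scale[OF lin] by auto
  have lin'': "q (t + t') s = q t s + q t' s" "q (c *\<^sub>R t) s = c * q t s" for s t t' c
    using lin' sym by metis+
  have CS: "q b t * q b t \<le> q b b * q t t" for t
  proof (cases "q b b = 0")
    case False
    \<comment> \<open>The minimizer of the form along \<open>t + c *\<^sub>R b\<close>.\<close>
    define c where "c = - q b t / q b b"
    have "0 \<le> q (t + c *\<^sub>R b) (t + c *\<^sub>R b)" by (rule psd)
    also have "\<dots> = q t t + 2 * c * q b t + c * c * q b b"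
      by (simp add: lin' lin'' sym[of t b] algebra_simps)
    also have "\<dots> = q t t - q b t * q b t / q b b"
      using False by (simp add: c_def field_simps)
    finally show ?thesis using False psd[of b] by (simp add: field_simps)
  next
    case True
    have "0 \<le> q (t + c *\<^sub>R b) (t + c *\<^sub>R b)" for c by (rule psd)
    then have *: "0 \<le> q t t + 2 * c * q b t" for c
      using True by (simp add: lin' lin'' sym[of t b] algebra_simps)
    \<comment> \<open>A vanishing \<open>q b b\<close> leaves an affine function of \<open>c\<close>
      that is nonnegative everywhere, so its slope is zero; otherwise the \<open>c\<close> chosen
      below would give the value -1.\<close>
    have "q b t = 0"
    proof (rule ccontr)
      assume "q b t \<noteq> 0"
      then show False using *[of "- (q t t + 1) / (2 * q b t)"] by (simp add: field_simps)
    qed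
    then show ?thesis using True by simp
  qed
  define s where "s = sqrt (q b b)"
  have ss: "s * s = q b b" using psd[of b] by (simp add: s_def)
  \<comment> \<open>For \<open>s = 0\<close> division by zero makes \<open>l\<close> vanish, so
    \<open>q' = q\<close>. This is the right value, since \<open>CS\<close> then already gives
    \<open>q b u = 0\<close> for all \<open>u\<close>.\<close>
  define l where "l t = q b t / s" for t
  define q' where "q' u t = q u t - l u * l t" for u t
  have l_lin: "linear l"
    by (rule linearI) (simp_all add: l_def lin' add_divide_distrib)
  have lb: "l u * l b = q u b" for u
  proof (cases "s = 0")
    case True
    with ss have "q b b = 0" by simp
    with CS[of u] have "(q b u)\<^sup>2 \<le> 0" by (simp add: power2_eq_square)
    then have "q b u = 0" by simp
    then show ?thesis by (simp add: l_def sym)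
  next
    case False
    then have "q b b \<noteq> 0" using ss by auto
    have "l u * l b = q b u * q b b / (s * s)" by (simp add: l_def)
    then show ?thesis using \<open>q b b \<noteq> 0\<close> unfolding ss by (simp add: sym[of u b])
  qed
  have "\<exists>\<mu>. prob_space \<mu> \<and> sets \<mu> = sets borel \<and>
    (\<forall>t. (\<integral>x. cis (t \<bullet> x) \<partial>\<mu>) = complex_of_real (exp (- (q' t t) / 2)))"
  proof (rule insert.IH[of q'])
    show "S \<subseteq> Basis" using insert.prems by simp
    show "linear (q' s)" for s
      by (rule linearI) (simp_all add: q'_def lin' linear_add[OF l_lin] linear_scale[OF l_lin] algebra_simps)
    show "q' s t = q' t s" for s t by (simp add: q'_def sym mult.commute)
    show "q' t t \<ge> 0" for t
    proof (cases "s = 0")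
      case False
      then have "q b b \<noteq> 0" using ss by auto
      then have "q b b > 0" using psd[of b] by simp
      moreover have "q' t t = q t t - q b t * q b t / q b b" by (simp add: q'_def l_def ss)
      ultimately show ?thesis using CS[of t] by (simp add: pos_divide_le_eq mult.commute)
    qed (simp add: q'_def l_def psd)
    fix c t assume c: "c \<in> Basis - S"
    show "q' c t = 0"
    proof (cases "c = b")
      case True
      have "q' b t = q' t b" by (simp add: q'_def sym mult.commute)
      also have "\<dots> = 0" by (simp add: q'_def lb)
      finally show ?thesis using True by simp
    next
      case False
      then have "q c u = 0" for u using c insert.prems(5) by auto
      then show ?thesis by (simp add: q'_def l_def sym[of b c])
    qed
  qed
  then obtain \<mu> where \<mu>: "prob_space \<mu>" "sets \<mu> = sets borel"
    "\<And>t. (\<integral>x. cis (t \<bullet> x) \<partial>\<mu>) = complex_of_real (exp (- (q' t t) / 2))" by blast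
  \<comment> \<open>\<open>a\<close> represents \<open>l\<close> through the inner product, so
    adding an independent \<open>z *\<^sub>R a\<close> multiplies the characteristic function by
    \<open>exp (- (l t)\<^sup>2 / 2)\<close>, the factor lost in passing from \<open>q\<close> to
    \<open>q'\<close>.\<close>
  define a where "a = (\<Sum>b\<in>Basis. l b *\<^sub>R b)"
  have la: "l t = t \<bullet> a" for t
  proof -
    have "l t = l (\<Sum>b\<in>Basis. (t \<bullet> b) *\<^sub>R b)" by (simp add: euclidean_representation)
    also have "\<dots> = (\<Sum>b\<in>Basis. (t \<bullet> b) * l b)" by (simp add: linear_sum[OF l_lin] linear_scale[OF l_lin])
    finally show ?thesis by (simp add: a_def inner_sum_right mult.commute)
  qed
  interpret \<mu>: prob_space \<mu> by fact
  interpret N: prob_space std_normal_distribution by (rule prob_space_normal_density) simp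
  interpret P: pair_prob_space \<mu> std_normal_distribution ..
  note [measurable_cong] = \<mu>(2)
  let ?\<nu> = "distr (\<mu> \<Otimes>\<^sub>M std_normal_distribution) borel (\<lambda>(x, z). x + z *\<^sub>R a)"
  show ?case
  proof (intro exI[of _ ?\<nu>] conjI allI)
    show "prob_space ?\<nu>" by (rule P.prob_space_distr) measurable
    show "sets ?\<nu> = sets borel" by simp
    fix t
    have int: "integrable (\<mu> \<Otimes>\<^sub>M std_normal_distribution) (\<lambda>(x, z). cis (t \<bullet> x) * cis (l t * z))"
      unfolding cis_mult case_prod_beta by (rule P.integrable_cis) measurable
    have "(\<integral>x. cis (t \<bullet> x) \<partial>?\<nu>) = (\<integral>p. (case p of (x, z) \<Rightarrow> cis (t \<bullet> x) * cis (l t * z)) \<partial>(\<mu> \<Otimes>\<^sub>M std_normal_distribution))"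
      by (subst integral_distr) (auto simp: la split_beta' cis_mult inner_add_right mult.commute
)
    also have "\<dots> = (\<integral>x. (\<integral>z. cis (t \<bullet> x) * cis (l t * z) \<partial>std_normal_distribution) \<partial>\<mu>)"
      using P.integral_fst'[OF int] by simp
    also have "\<dots> = complex_of_real (exp (- (q' t t) / 2)) * complex_of_real (exp (- (l t)\<^sup>2 / 2))"
      by (simp add: gaussian_char_scale \<mu>(3))
    also have "\<dots> = complex_of_real (exp (- (q t t) / 2))"
      unfolding of_real_mult[symmetric] exp_add[symmetric]
      by (simp add: q'_def power2_eq_square field_simps)
    finally show "(\<integral>x. cis (t \<bullet> x) \<partial>?\<nu>) = complex_of_real (exp (- (q t t) / 2))" .
  qed
qed

lemma gaussian_exists:
  fixes q :: "'a::euclidean_space \<Rightarrow> 'a \<Rightarrow> real"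
  assumes "\<And>s. linear (q s)" "\<And>s t. q s t = q t s" "\<And>t. q t t \<ge> 0"
  obtains \<mu> where "prob_space \<mu>" "sets \<mu> = sets borel"
    "\<And>t. (\<integral>x. cis (t \<bullet> x) \<partial>\<mu>) = complex_of_real (exp (- (q t t) / 2))"
  using gaussian_exists_aux[of Basis q] assms by auto

section \<open>Normalized sums of independent vectors\<close>

text \<open>Independence and zero means remove the cross terms. The nonnegative integral and a bound
  that may be infinite allow an application inside an iterated integral, where finiteness at each
  point of the outer variable is not known.\<close>

lemma (in prob_space) nn_integral_norm_sum_square_le:
  fixes V :: "nat \<Rightarrow> 'a \<Rightarrow> 'b::euclidean_space"
  assumes indep: "indep_vars (\<lambda>_. borel) V UNIV" and zero: "\<And>i. expectation (V i) = 0"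
    and c: "\<And>i. (\<integral>\<^sup>+x. ennreal ((norm (V i x))\<^sup>2) \<partial>M) \<le> c"
  shows "(\<integral>\<^sup>+x. ennreal ((norm (\<Sum>i<n. V i x))\<^sup>2) \<partial>M) \<le> of_nat n * c"
proof (cases "n = 0 \<or> c = \<top>")
  case True
  then show ?thesis by (auto simp: ennreal_mult_top)
next
  case False
  then have fin: "c < \<top>" by (simp add: less_top)
  have [measurable]: "V i \<in> borel_measurable M" for i using indep by (auto simp: indep_vars_def)
  have sq: "integrable M (\<lambda>x. (norm (V i x))\<^sup>2)" for i
    using order.strict_trans1[OF c fin] by (intro integrableI_bounded) (auto simp: less_top)
  have int: "integrable M (V i)" for i
    using square_integrable_imp_integrable[OF _ sq[of i]] by (simp add: integrable_norm_iff)
  have prod_int: "integrable M (\<lambda>x. V i x \<bullet> V j x)" for i j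
  proof (rule Bochner_Integration.integrable_bound)
    show "integrable M (\<lambda>x. (norm (V i x))\<^sup>2 + (norm (V j x))\<^sup>2)" using sq by auto
    show "AE x in M. norm (V i x \<bullet> V j x) \<le> norm ((norm (V i x))\<^sup>2 + (norm (V j x))\<^sup>2)"
    proof (intro AE_I2)
      fix x
      have "\<bar>V i x \<bullet> V j x\<bar> \<le> norm (V i x) * norm (V j x)" by (rule Cauchy_Schwarz_ineq2)
      also have "\<dots> \<le> (norm (V i x))\<^sup>2 + (norm (V j x))\<^sup>2"
        using sum_squares_bound[of "norm (V i x)" "norm (V j x)"]
          mult_nonneg_nonneg[OF norm_ge_zero[of "V i x"] norm_ge_zero[of "V j x"]] by linarith
      finally show "norm (V i x \<bullet> V j x) \<le> norm ((norm (V i x))\<^sup>2 + (norm (V j x))\<^sup>2)" by simp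
    qed
  qed simp
  have cross: "expectation (\<lambda>x. V i x \<bullet> V j x) = 0" if "i \<noteq> j" for i j
  proof -
    have ind: "indep_vars (\<lambda>_. borel) V {i, j}" by (rule indep_vars_subset[OF indep]) auto
    \<comment> \<open>Independence factorizes products of scalars, so the inner product is treated
      coordinate by coordinate.\<close>
    have *: "expectation (\<lambda>x. (V i x \<bullet> b) * (V j x \<bullet> b)) = 0"
      and **: "integrable M (\<lambda>x. (V i x \<bullet> b) * (V j x \<bullet> b))" for b
    proof -
      have ind': "indep_vars (\<lambda>_. borel) (\<lambda>k x. V k x \<bullet> b) {i, j}"
        by (rule indep_vars_compose2[OF ind]) auto
      have "expectation (\<lambda>x. \<Prod>k\<in>{i, j}. V k x \<bullet> b) = (\<Prod>k\<in>{i, j}. expectation (\<lambda>x. V k x \<bullet> b))"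
        by (rule indep_vars_lebesgue_integral[OF _ ind']) (auto simp: int)
      then show "expectation (\<lambda>x. (V i x \<bullet> b) * (V j x \<bullet> b)) = 0"
        using that by (simp add: int zero)
      have "integrable M (\<lambda>x. \<Prod>k\<in>{i, j}. V k x \<bullet> b)"
        by (rule indep_vars_integrable[OF _ ind']) (auto simp: int)
      then show "integrable M (\<lambda>x. (V i x \<bullet> b) * (V j x \<bullet> b))" using that by simp
    qed
    show ?thesis by (subst euclidean_inner) (simp add: * **)
  qed
  have "(norm (\<Sum>i<n. V i x))\<^sup>2 = (\<Sum>i<n. \<Sum>j<n. V i x \<bullet> V j x)" for x
    by (simp add: power2_norm_eq_inner inner_sum_left inner_sum_right) (rule sum.swap)
  then have "expectation (\<lambda>x. (norm (\<Sum>i<n. V i x))\<^sup>2) = (\<Sum>i<n. \<Sum>j<n. expectation (\<lambda>x. V i x \<bullet> V j x))"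
    by (simp add: prod_int)
  also have "\<dots> = (\<Sum>i<n. expectation (\<lambda>x. V i x \<bullet> V i x))"
    by (intro sum.cong refl, subst sum.remove) (auto intro!: sum.neutral simp: cross)
  also have "\<dots> \<le> (\<Sum>i<n. enn2real c)"
  proof (rule sum_mono)
    fix i
    have "ennreal (expectation (\<lambda>x. V i x \<bullet> V i x)) \<le> c"
      using c[of i] nn_integral_eq_integral[OF sq[of i]] by (simp add: power2_norm_eq_inner)
    then show "expectation (\<lambda>x. V i x \<bullet> V i x) \<le> enn2real c"
      using fin by (cases c) auto
  qed
  finally have le: "expectation (\<lambda>x. (norm (\<Sum>i<n. V i x))\<^sup>2) \<le> n * enn2real c" by simp
  have "integrable M (\<lambda>x. (norm (\<Sum>i<n. V i x))\<^sup>2)"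
    using \<open>\<And>x. (norm (\<Sum>i<n. V i x))\<^sup>2 = _\<close> by (simp add: prod_int)
  then have "(\<integral>\<^sup>+x. ennreal ((norm (\<Sum>i<n. V i x))\<^sup>2) \<partial>M) = ennreal (expectation (\<lambda>x. (norm (\<Sum>i<n. V i x))\<^sup>2))"
    by (intro nn_integral_eq_integral) auto
  also have "\<dots> \<le> ennreal (n * enn2real c)" using le by (rule ennreal_leI)
  also have "\<dots> = of_nat n * c" using fin by (simp add: ennreal_mult ennreal_of_nat_eq_real_of_nat)
  finally show ?thesis .
qed

text \<open>Projecting onto \<open>t\<close> reduces the claim to the central limit theorem on the
  line. That theorem asks for positive variance; with variance zero the projections vanish almost
  surely, and the sequence is constantly 1, like its limit.\<close>

lemma (in prob_space) char_normalized_sum_tendsto: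
  fixes V :: "nat \<Rightarrow> 'a \<Rightarrow> 'b::euclidean_space"
  assumes indep: "indep_vars (\<lambda>_. borel) V UNIV" and law: "\<And>i. distr M borel (V i) = \<nu>"
    and zero: "\<And>i. expectation (V i) = 0" and sq: "\<And>i. integrable M (\<lambda>x. (norm (V i x))\<^sup>2)"
  shows "(\<lambda>n. expectation (\<lambda>x. cis (t \<bullet> ((1 / sqrt (real n)) *\<^sub>R (\<Sum>i<n. V i x)))))
    \<longlonglongrightarrow> complex_of_real (exp (- (expectation (\<lambda>x. (t \<bullet> V 0 x)\<^sup>2)) / 2))"
proof -
  have [measurable]: "V i \<in> borel_measurable M" for i using indep by (auto simp: indep_vars_def)
  have int: "integrable M (V i)" for i
    using square_integrable_imp_integrable[OF _ sq[of i]] by (simp add: integrable_norm_iff)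
  define W where "W i x = t \<bullet> V i x" for i x
  have [measurable]: "W i \<in> borel_measurable M" for i unfolding W_def by measurable
  have indW: "indep_vars (\<lambda>_. borel) W UNIV"
    unfolding W_def by (rule indep_vars_compose2[OF indep]) auto
  have zW: "expectation (W i) = 0" for i
    using integral_inner_left[of t M "V i", OF int] zero[of i] by (simp add: W_def[abs_def] inner_commute)
  have sqW: "integrable M (\<lambda>x. (W i x)\<^sup>2)" for i
  proof (rule Bochner_Integration.integrable_bound)
    show "integrable M (\<lambda>x. (norm t)\<^sup>2 * (norm (V i x))\<^sup>2)" using sq by auto
    show "AE x in M. norm ((W i x)\<^sup>2) \<le> norm ((norm t)\<^sup>2 * (norm (V i x))\<^sup>2)"
      using Cauchy_Schwarz_ineq2[of t] by (auto simp: W_def power_mult_distrib[symmetric] abs_le_square_iff[symmetric] abs_mult)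
  qed simp
  have lawW: "distr M borel (W i) = distr \<nu> borel (\<lambda>v. t \<bullet> v)" for i
    unfolding law[of i, symmetric] by (subst distr_distr) (auto simp: W_def[abs_def] comp_def)
  define s where "s = expectation (\<lambda>x. (W 0 x)\<^sup>2)"
  have s: "expectation (\<lambda>x. (W i x)\<^sup>2) = s" for i
  proof -
    have "expectation (\<lambda>x. (W i x)\<^sup>2) = (\<integral>u. u\<^sup>2 \<partial>distr M borel (W i))" for i by (simp add: integral_distr)
    then show ?thesis unfolding s_def lawW by simp
  qed
  have s0: "s \<ge> 0" unfolding s_def by simp
  have eq: "t \<bullet> ((1 / sqrt (real n)) *\<^sub>R (\<Sum>i<n. V i x)) = (\<Sum>i<n. W i x) / sqrt (real n)" for n x
    by (simp add: W_def inner_sum_right)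
  have goal: "(\<lambda>n. expectation (\<lambda>x. cis ((\<Sum>i<n. W i x) / sqrt (real n)))) \<longlonglongrightarrow> complex_of_real (exp (- s / 2))"
  proof (cases "s = 0")
    case True
    have "AE x in M. \<forall>i. W i x = 0"
    proof (subst AE_all_countable, intro allI)
      fix i
      have "AE x in M. (W i x)\<^sup>2 = 0"
        by (subst integral_nonneg_eq_0_iff_AE[symmetric]) (auto simp: sqW s True)
      then show "AE x in M. W i x = 0" by simp
    qed
    then have "expectation (\<lambda>x. cis ((\<Sum>i<n. W i x) / sqrt (real n))) = expectation (\<lambda>x. 1)" for n
      by (intro integral_cong_AE) auto
    then show ?thesis using True by (simp add: prob_space)
  next
    case False
    then have pos: "sqrt s > 0" using s0 by simp
    \<comment> \<open>\<open>?S\<close> is also normalized by the standard deviation; the test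
      function \<open>cis (sqrt s * u)\<close> puts the factor \<open>sqrt s\<close> back.\<close>
    let ?S = "\<lambda>n x. (\<Sum>i<n. W i x) / sqrt (real n * (sqrt s)\<^sup>2)"
    have "continuous_on UNIV (\<lambda>u. cis (sqrt s * u))" by (intro continuous_on_cis continuous_intros)
    then have cont: "isCont (\<lambda>u. cis (sqrt s * u)) u" for u by (simp add: continuous_on_eq_continuous_at)
    have "weak_conv_m (\<lambda>n. distr M borel (?S n)) std_normal_distribution"
      by (rule central_limit_theorem_zero_mean[OF indW zW pos sqW _ lawW]) (use s0 s zW in auto)
    then have "(\<lambda>n. \<integral>u. cis (sqrt s * u) \<partial>distr M borel (?S n)) \<longlonglongrightarrow> (\<integral>u. cis (sqrt s * u) \<partial>std_normal_distribution)"
      by (intro weak_conv_imp_integral_bdd_continuous_conv[where B=1] real_distribution_distr real_dist_normal_dist)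
         (use cont in auto)
    moreover have "(\<integral>u. cis (sqrt s * u) \<partial>distr M borel (?S n)) = expectation (\<lambda>x. cis ((\<Sum>i<n. W i x) / sqrt (real n)))" for n
      using pos s0 by (subst integral_distr) (auto simp: real_sqrt_mult)
    ultimately show ?thesis by (simp add: gaussian_char_scale s0)
  qed
  then show ?thesis unfolding eq s_def W_def .
qed

text \<open>Being uniform in \<open>n\<close>, this bound gives, by Markov's inequality, the
  tightness that \<open>conv_in_distr_of_char\<close> asks for.\<close>

lemma (in prob_space) normalized_sum_square_le:
  fixes V :: "nat \<Rightarrow> 'a \<Rightarrow> 'b::euclidean_space"
  assumes indep: "indep_vars (\<lambda>_. borel) V UNIV" and law: "\<And>i. distr M borel (V i) = \<nu>"
    and zero: "\<And>i. expectation (V i) = 0" and sq: "\<And>i. integrable M (\<lambda>x. (norm (V i x))\<^sup>2)"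
  shows "(\<integral>\<^sup>+x. ennreal ((norm ((1 / sqrt (real n)) *\<^sub>R (\<Sum>i<n. V i x)))\<^sup>2) \<partial>M) \<le> ennreal (expectation (\<lambda>x. (norm (V 0 x))\<^sup>2))"
proof -
  have [measurable]: "V i \<in> borel_measurable M" for i using indep by (auto simp: indep_vars_def)
  have E: "expectation (\<lambda>x. (norm (V i x))\<^sup>2) = expectation (\<lambda>x. (norm (V 0 x))\<^sup>2)" for i
  proof -
    have "expectation (\<lambda>x. (norm (V i x))\<^sup>2) = (\<integral>v. (norm v)\<^sup>2 \<partial>\<nu>)" for i
      unfolding law[of i, symmetric] by (simp add: integral_distr)
    then show ?thesis by simp
  qed
  let ?c = "expectation (\<lambda>x. (norm (V 0 x))\<^sup>2)"
  have c: "(\<integral>\<^sup>+x. ennreal ((norm (V i x))\<^sup>2) \<partial>M) \<le> ennreal ?c" for i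
    using E[of i] by (subst nn_integral_eq_integral[OF sq]) auto
  have "(\<integral>\<^sup>+x. ennreal ((norm ((1 / sqrt (real n)) *\<^sub>R (\<Sum>i<n. V i x)))\<^sup>2) \<partial>M)
     = ennreal (1 / n) * (\<integral>\<^sup>+x. ennreal ((norm (\<Sum>i<n. V i x))\<^sup>2) \<partial>M)"
    by (subst nn_integral_cmult[symmetric]) (auto simp: power_mult_distrib power_divide ennreal_mult[symmetric])
  also have "\<dots> \<le> ennreal (1 / n) * (of_nat n * ennreal ?c)"
    by (intro mult_left_mono nn_integral_norm_sum_square_le[OF indep zero c]) auto
  also have "\<dots> \<le> ennreal ?c"
    by (cases "n = 0") (auto simp: ennreal_of_nat_eq_real_of_nat ennreal_mult[symmetric])
  finally show ?thesis .
qed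

lemma (in prob_space) markov_norm_square:
  fixes Z :: "'a \<Rightarrow> 'b::euclidean_space"
  assumes [measurable]: "Z \<in> borel_measurable M" and c: "(\<integral>\<^sup>+x. ennreal ((norm (Z x))\<^sup>2) \<partial>M) \<le> ennreal c"
    and "c \<ge> 0" "R > 0"
  shows "measure (distr M borel Z) {z. norm z > R} \<le> c / R\<^sup>2"
proof -
  have "emeasure M {x \<in> space M. norm (Z x) > R} \<le> emeasure M {x \<in> space M. 1 \<le> ennreal (1 / R\<^sup>2) * ennreal ((norm (Z x))\<^sup>2)}"
  proof (rule emeasure_mono)
    show "{x \<in> space M. norm (Z x) > R} \<subseteq> {x \<in> space M. 1 \<le> ennreal (1 / R\<^sup>2) * ennreal ((norm (Z x))\<^sup>2)}"
    proof (intro subsetI CollectI conjI; elim CollectE conjE)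
      fix x assume "norm (Z x) > R"
      then have "R\<^sup>2 \<le> (norm (Z x))\<^sup>2" using \<open>R > 0\<close> by (intro power_mono) auto
      then have "1 \<le> (1 / R\<^sup>2) * (norm (Z x))\<^sup>2" using \<open>R > 0\<close> by (simp add: field_simps)
      then have "ennreal 1 \<le> ennreal ((1 / R\<^sup>2) * (norm (Z x))\<^sup>2)" by (rule ennreal_leI)
      then show "1 \<le> ennreal (1 / R\<^sup>2) * ennreal ((norm (Z x))\<^sup>2)" by (simp add: ennreal_mult[symmetric])
    qed
  qed measurable
  also have "\<dots> \<le> ennreal (1 / R\<^sup>2) * (\<integral>\<^sup>+x. ennreal ((norm (Z x))\<^sup>2) * indicator (space M) x \<partial>M)"
    by (rule nn_integral_Markov_inequality) auto
  also have "\<dots> = ennreal (1 / R\<^sup>2) * (\<integral>\<^sup>+x. ennreal ((norm (Z x))\<^sup>2) \<partial>M)"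
    by (intro arg_cong2[where f="(*)"] refl nn_integral_cong) simp
  also have "\<dots> \<le> ennreal (1 / R\<^sup>2) * ennreal c" using c by (rule mult_left_mono) simp
  also have "\<dots> = ennreal (c / R\<^sup>2)" using assms by (simp add: ennreal_mult[symmetric])
  finally have "measure M {x \<in> space M. norm (Z x) > R} \<le> c / R\<^sup>2"
    using assms by (simp add: emeasure_eq_measure)
  also have "measure M {x \<in> space M. norm (Z x) > R} = measure (distr M borel Z) {z. norm z > R}"
    by (subst measure_distr) (auto intro!: arg_cong[where f="measure M"])
  finally show ?thesis .
qed

text \<open>Independence of the two families enters as factorization of the characteristic functions
  of their sums. The limit factors in the same way, which identifies it as the characteristic
  function of \<open>\<mu>1 \<Otimes>\<^sub>M \<mu>2\<close>; tightness of the pair comes from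
  adding the two second moments.\<close>

theorem (in prob_space) joint_central_limit:
  fixes V :: "nat \<Rightarrow> 'a \<Rightarrow> 'b::euclidean_space" and W :: "nat \<Rightarrow> 'a \<Rightarrow> 'c::euclidean_space"
  assumes V: "indep_vars (\<lambda>_. borel) V UNIV" "\<And>i. distr M borel (V i) = \<nu>"
      "\<And>i. expectation (V i) = 0" "\<And>i. integrable M (\<lambda>x. (norm (V i x))\<^sup>2)"
    and W: "indep_vars (\<lambda>_. borel) W UNIV" "\<And>i. distr M borel (W i) = \<nu>'"
      "\<And>i. expectation (W i) = 0" "\<And>i. integrable M (\<lambda>x. (norm (W i x))\<^sup>2)"
    and VW: "\<And>n a b. expectation (\<lambda>x. cis (a \<bullet> (\<Sum>i<n. V i x)) * cis (b \<bullet> (\<Sum>i<n. W i x)))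
      = expectation (\<lambda>x. cis (a \<bullet> (\<Sum>i<n. V i x))) * expectation (\<lambda>x. cis (b \<bullet> (\<Sum>i<n. W i x)))"
    and \<mu>1: "prob_space \<mu>1" "sets \<mu>1 = sets borel"
      "\<And>t. (\<integral>v. cis (t \<bullet> v) \<partial>\<mu>1) = complex_of_real (exp (- (expectation (\<lambda>x. (t \<bullet> V 0 x)\<^sup>2)) / 2))"
    and \<mu>2: "prob_space \<mu>2" "sets \<mu>2 = sets borel"
      "\<And>t. (\<integral>v. cis (t \<bullet> v) \<partial>\<mu>2) = complex_of_real (exp (- (expectation (\<lambda>x. (t \<bullet> W 0 x)\<^sup>2)) / 2))"
  shows "conv_in_distr (\<lambda>n. distr M borel (\<lambda>x. ((1 / sqrt (real n)) *\<^sub>R (\<Sum>i<n. V i x), (1 / sqrt (real n)) *\<^sub>R (\<Sum>i<n. W i x))))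
    (\<mu>1 \<Otimes>\<^sub>M \<mu>2)"
proof (rule conv_in_distr_of_char)
  have [measurable]: "V i \<in> borel_measurable M" "W i \<in> borel_measurable M" for i
    using V(1) W(1) by (auto simp: indep_vars_def)
  define v where "v n x = (1 / sqrt (real n)) *\<^sub>R (\<Sum>i<n. V i x)" for n x
  define w where "w n x = (1 / sqrt (real n)) *\<^sub>R (\<Sum>i<n. W i x)" for n x
  have [measurable]: "v n \<in> borel_measurable M" "w n \<in> borel_measurable M" for n
    unfolding v_def w_def by measurable
  have vw: "(\<lambda>x. ((1 / sqrt (real n)) *\<^sub>R (\<Sum>i<n. V i x), (1 / sqrt (real n)) *\<^sub>R (\<Sum>i<n. W i x))) = (\<lambda>x. (v n x, w n x))" for n
    by (simp add: v_def w_def)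
  interpret \<mu>1: prob_space \<mu>1 by fact
  interpret \<mu>2: prob_space \<mu>2 by fact
  interpret \<mu>12: pair_prob_space \<mu>1 \<mu>2 ..
  note [measurable_cong] = \<mu>1(2) \<mu>2(2)
  show "prob_space (distr M borel (\<lambda>x. ((1 / sqrt (real n)) *\<^sub>R (\<Sum>i<n. V i x), (1 / sqrt (real n)) *\<^sub>R (\<Sum>i<n. W i x))))" for n
    unfolding vw by (rule prob_space_distr) measurable
  show "prob_space (\<mu>1 \<Otimes>\<^sub>M \<mu>2)" by unfold_locales
  show "sets (\<mu>1 \<Otimes>\<^sub>M \<mu>2) = sets borel"
    using sets_pair_measure_cong[OF \<mu>1(2) \<mu>2(2)] by (simp only: borel_prod)
  show "(\<lambda>n. \<integral>x. cis (t \<bullet> x) \<partial>distr M borel (\<lambda>x. ((1 / sqrt (real n)) *\<^sub>R (\<Sum>i<n. V i x), (1 / sqrt (real n)) *\<^sub>R (\<Sum>i<n. W i x))))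
    \<longlonglongrightarrow> (\<integral>x. cis (t \<bullet> x) \<partial>(\<mu>1 \<Otimes>\<^sub>M \<mu>2))" for t
  proof -
    obtain a b where t: "t = (a, b)" by fastforce
    have int: "integrable (\<mu>1 \<Otimes>\<^sub>M \<mu>2) (\<lambda>(x, y). cis (a \<bullet> x) * cis (b \<bullet> y))"
      unfolding cis_mult case_prod_beta by (rule \<mu>12.integrable_cis) measurable
    have "(\<integral>x. cis (t \<bullet> x) \<partial>(\<mu>1 \<Otimes>\<^sub>M \<mu>2)) = (\<integral>p. (case p of (x, y) \<Rightarrow> cis (a \<bullet> x) * cis (b \<bullet> y)) \<partial>(\<mu>1 \<Otimes>\<^sub>M \<mu>2))"
      by (simp add: t case_prod_beta' cis_mult inner_prod_def)
    also have "\<dots> = (\<integral>x. (\<integral>y. cis (a \<bullet> x) * cis (b \<bullet> y) \<partial>\<mu>2) \<partial>\<mu>1)"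
      using \<mu>12.integral_fst'[OF int] by simp
    finally have lim: "(\<integral>x. cis (t \<bullet> x) \<partial>(\<mu>1 \<Otimes>\<^sub>M \<mu>2)) = (\<integral>x. cis (a \<bullet> x) \<partial>\<mu>1) * (\<integral>y. cis (b \<bullet> y) \<partial>\<mu>2)"
      by simp
    have m: "(\<lambda>z. cis (a \<bullet> fst z + b \<bullet> snd z)) \<in> borel_measurable (borel :: ('b \<times> 'c) measure)"
      by (intro borel_measurable_continuous_onI continuous_on_cis continuous_intros)
    have fac: "(\<integral>x. cis (t \<bullet> x) \<partial>distr M borel (\<lambda>x. (v n x, w n x))) = expectation (\<lambda>x. cis (a \<bullet> v n x)) * expectation (\<lambda>x. cis (b \<bullet> w n x))" for n
    proof -
      have "(\<integral>x. cis (t \<bullet> x) \<partial>distr M borel (\<lambda>x. (v n x, w n x))) = expectation (\<lambda>x. cis (a \<bullet> v n x) * cis (b \<bullet> w n x))"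
        using m by (subst integral_distr) (auto simp: t cis_mult inner_prod_def)
      also have "\<dots> = expectation (\<lambda>x. cis (a \<bullet> v n x)) * expectation (\<lambda>x. cis (b \<bullet> w n x))"
        using VW[of "(1 / sqrt (real n)) *\<^sub>R a" n "(1 / sqrt (real n)) *\<^sub>R b"] by (simp add: v_def w_def)
      finally show ?thesis .
    qed
    have "(\<lambda>n. expectation (\<lambda>x. cis (a \<bullet> v n x)) * expectation (\<lambda>x. cis (b \<bullet> w n x)))
      \<longlonglongrightarrow> (\<integral>x. cis (a \<bullet> x) \<partial>\<mu>1) * (\<integral>y. cis (b \<bullet> y) \<partial>\<mu>2)"
      unfolding \<mu>1(3) \<mu>2(3) v_def w_def
      by (rule tendsto_mult[OF char_normalized_sum_tendsto[OF V] char_normalized_sum_tendsto[OF W]])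
    then show ?thesis unfolding vw lim fac .
  qed
  show "\<exists>R. \<forall>n. measure (distr M borel (\<lambda>x. ((1 / sqrt (real n)) *\<^sub>R (\<Sum>i<n. V i x), (1 / sqrt (real n)) *\<^sub>R (\<Sum>i<n. W i x)))) {x. norm x > R} \<le> e"
    if e: "e > 0" for e
  proof -
    define c where "c = expectation (\<lambda>x. (norm (V 0 x))\<^sup>2) + expectation (\<lambda>x. (norm (W 0 x))\<^sup>2)"
    have c0: "c \<ge> 0" by (simp add: c_def)
    have "(\<integral>\<^sup>+x. ennreal ((norm (v n x, w n x))\<^sup>2) \<partial>M) \<le> ennreal c" for n
    proof -
      have "(\<integral>\<^sup>+x. ennreal ((norm (v n x, w n x))\<^sup>2) \<partial>M) = (\<integral>\<^sup>+x. ennreal ((norm (v n x))\<^sup>2) \<partial>M) + (\<integral>\<^sup>+x. ennreal ((norm (w n x))\<^sup>2) \<partial>M)"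
        by (subst nn_integral_add[symmetric]) (auto simp: norm_prod_def)
      also have "\<dots> \<le> ennreal (expectation (\<lambda>x. (norm (V 0 x))\<^sup>2)) + ennreal (expectation (\<lambda>x. (norm (W 0 x))\<^sup>2))"
        unfolding v_def w_def by (intro add_mono normalized_sum_square_le[OF V] normalized_sum_square_le[OF W])
      finally show ?thesis by (simp add: c_def)
    qed
    then have tail: "measure (distr M borel (\<lambda>x. (v n x, w n x))) {z. norm z > R} \<le> c / R\<^sup>2" if "R > 0" for n R
      using c0 that by (intro markov_norm_square) auto
    \<comment> \<open>The summand 1 keeps \<open>R\<close> positive when
      \<open>c = 0\<close>.\<close>
    define R where "R = sqrt ((c + 1) / e)"
    have R: "R > 0" "R\<^sup>2 = (c + 1) / e" using e c0 by (auto simp: R_def)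
    then have "c / R\<^sup>2 \<le> e" using e c0 by (simp add: field_simps)
    then have "\<forall>n. measure (distr M borel (\<lambda>x. (v n x, w n x))) {z. norm z > R} \<le> e"
      using tail[OF R(1)] by (auto intro: order.trans)
    then show ?thesis unfolding vw by (rule exI)
  qed
qed simp

text \<open>A bounded continuous function of one coordinate is itself a test function on the
  product, and the other factor, having mass 1, drops out of its integral.\<close>

lemma conv_in_distr_marginals:
  assumes conv: "conv_in_distr (\<lambda>n. distr M borel (\<lambda>x. (F n x :: 'b::euclidean_space, G n x :: 'c::euclidean_space))) (\<mu>1 \<Otimes>\<^sub>M \<mu>2)"
    and [measurable]: "\<And>n. F n \<in> borel_measurable M" "\<And>n. G n \<in> borel_measurable M"
    and \<mu>: "prob_space \<mu>1" "prob_space \<mu>2" and sets: "sets \<mu>1 = sets borel" "sets \<mu>2 = sets borel"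
  shows "conv_in_distr (\<lambda>n. distr M borel (F n)) \<mu>1" "conv_in_distr (\<lambda>n. distr M borel (G n)) \<mu>2"
proof -
  interpret \<mu>1: prob_space \<mu>1 by fact
  interpret \<mu>2: prob_space \<mu>2 by fact
  interpret \<mu>12: pair_prob_space \<mu>1 \<mu>2 ..
  note [measurable_cong] = sets
  have C: "(\<lambda>n. \<integral>z. g z \<partial>distr M borel (\<lambda>x. (F n x, G n x))) \<longlonglongrightarrow> (\<integral>z. g z \<partial>(\<mu>1 \<Otimes>\<^sub>M \<mu>2))"
    if "continuous_on UNIV g" "bounded (range g)" for g :: "'b \<times> 'c \<Rightarrow> real"
    using conv[unfolded conv_in_distr_def, rule_format, of g] that by simp
  show "conv_in_distr (\<lambda>n. distr M borel (F n)) \<mu>1"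
    unfolding conv_in_distr_def
  proof (intro allI impI)
    fix g :: "'b \<Rightarrow> real" assume g: "continuous_on UNIV g \<and> bounded (range g)"
    then have [measurable]: "g \<in> borel_measurable borel" by (intro borel_measurable_continuous_onI) auto
    obtain B where B: "\<And>x. \<bar>g x\<bar> \<le> B" using g unfolding bounded_iff by auto
    have cont: "continuous_on UNIV (\<lambda>z::'b \<times> 'c. g (fst z))"
      using g continuous_on_compose2[of UNIV g UNIV "fst :: 'b \<times> 'c \<Rightarrow> 'b"] continuous_on_fst[OF continuous_on_id] by auto
    have bdd: "bounded (range (\<lambda>z::'b \<times> 'c. g (fst z)))" using B by (auto simp: bounded_iff)
    have lim: "(\<lambda>n. \<integral>z. g (fst z) \<partial>distr M borel (\<lambda>x. (F n x, G n x))) \<longlonglongrightarrow> (\<integral>z. g (fst z) \<partial>(\<mu>1 \<Otimes>\<^sub>M \<mu>2))"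
      by (rule C[OF cont bdd])
    have prod: "(\<integral>z. g (fst z) \<partial>(\<mu>1 \<Otimes>\<^sub>M \<mu>2)) = (\<integral>x. g x \<partial>\<mu>1)"
    proof -
      have "integrable (\<mu>1 \<Otimes>\<^sub>M \<mu>2) (\<lambda>z. g (fst z))"
        by (rule \<mu>12.P.integrable_const_bound[where B=B]) (use B in auto)
      from \<mu>12.integral_fst'[OF this] show ?thesis by (simp add: \<mu>2.prob_space)
    qed
    have "(\<integral>z. g (fst z) \<partial>distr M borel (\<lambda>x. (F n x, G n x))) = (\<integral>x. g x \<partial>distr M borel (F n))" for n
      by (subst (1 2) integral_distr) (simp_all add: borel_measurable_continuous_onI[OF cont])
    then show "(\<lambda>n. \<integral>x. g x \<partial>distr M borel (F n)) \<longlonglongrightarrow> (\<integral>x. g x \<partial>\<mu>1)"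
      using lim unfolding prod by simp
  qed
  show "conv_in_distr (\<lambda>n. distr M borel (G n)) \<mu>2"
    unfolding conv_in_distr_def
  proof (intro allI impI)
    fix g :: "'c \<Rightarrow> real" assume g: "continuous_on UNIV g \<and> bounded (range g)"
    then have [measurable]: "g \<in> borel_measurable borel" by (intro borel_measurable_continuous_onI) auto
    obtain B where B: "\<And>x. \<bar>g x\<bar> \<le> B" using g unfolding bounded_iff by auto
    have cont: "continuous_on UNIV (\<lambda>z::'b \<times> 'c. g (snd z))"
      using g continuous_on_compose2[of UNIV g UNIV "snd :: 'b \<times> 'c \<Rightarrow> 'c"] continuous_on_snd[OF continuous_on_id] by auto
    have bdd: "bounded (range (\<lambda>z::'b \<times> 'c. g (snd z)))" using B by (auto simp: bounded_iff)
    have lim: "(\<lambda>n. \<integral>z. g (snd z) \<partial>distr M borel (\<lambda>x. (F n x, G n x))) \<longlonglongrightarrow> (\<integral>z. g (snd z) \<partial>(\<mu>1 \<Otimes>\<^sub>M \<mu>2))"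
      by (rule C[OF cont bdd])
    have prod: "(\<integral>z. g (snd z) \<partial>(\<mu>1 \<Otimes>\<^sub>M \<mu>2)) = (\<integral>x. g x \<partial>\<mu>2)"
    proof -
      have "integrable (\<mu>1 \<Otimes>\<^sub>M \<mu>2) (\<lambda>z. g (snd z))"
        by (rule \<mu>12.P.integrable_const_bound[where B=B]) (use B in auto)
      from \<mu>12.integral_fst'[OF this] show ?thesis by (simp add: \<mu>1.prob_space)
    qed
    have "(\<integral>z. g (snd z) \<partial>distr M borel (\<lambda>x. (F n x, G n x))) = (\<integral>x. g x \<partial>distr M borel (G n))" for n
      by (subst (1 2) integral_distr) (simp_all add: borel_measurable_continuous_onI[OF cont])
    then show "(\<lambda>n. \<integral>x. g x \<partial>distr M borel (G n)) \<longlonglongrightarrow> (\<integral>x. g x \<partial>\<mu>2)"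
      using lim unfolding prod by simp
  qed
qed

section \<open>Two-sample expansion of an empirical ratio\<close>

lemma (in prob_space) indep_vars_coordinates:
  "prob_space.indep_vars (PiM UNIV (\<lambda>_::'i. M)) (\<lambda>_. M) (\<lambda>i \<omega>. \<omega> i) UNIV"
proof -
  interpret PP: prob_space "PiM UNIV (\<lambda>_::'i. M)" by (intro prob_space_PiM) unfold_locales
  have comp: "distr (PiM UNIV (\<lambda>_::'i. M)) M (\<lambda>\<omega>. \<omega> i) = M" for i
    by (rule distr_PiM_component) (auto intro: prob_space_axioms)
  show ?thesis
    by (subst PP.indep_vars_iff_distr_eq_PiM) (auto simp: comp distr_id2 restrict_UNIV)
qed

lemma (in prob_space) nn_integral_component:
  assumes [measurable]: "f \<in> borel_measurable M"
  shows "(\<integral>\<^sup>+\<omega>. f (\<omega> i) \<partial>PiM UNIV (\<lambda>_::'i. M)) = (\<integral>\<^sup>+x. f x \<partial>M)"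
proof -
  have comp: "distr (PiM UNIV (\<lambda>_::'i. M)) M (\<lambda>\<omega>. \<omega> i) = M"
    by (rule distr_PiM_component) (auto intro: prob_space_axioms)
  show ?thesis by (subst (2) comp[symmetric], subst nn_integral_distr) auto
qed

lemma (in prob_space) integral_component:
  fixes f :: "'a \<Rightarrow> 'b::{banach, second_countable_topology}"
  assumes [measurable]: "f \<in> borel_measurable M"
  shows "(\<integral>\<omega>. f (\<omega> i) \<partial>PiM UNIV (\<lambda>_::'i. M)) = (\<integral>x. f x \<partial>M)"
proof -
  have comp: "distr (PiM UNIV (\<lambda>_::'i. M)) M (\<lambda>\<omega>. \<omega> i) = M"
    by (rule distr_PiM_component) (auto intro: prob_space_axioms)
  show ?thesis by (subst (2) comp[symmetric], subst integral_distr) auto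
qed

lemma (in prob_space) nn_integral_iid_sum_square_le:
  fixes V :: "'a \<Rightarrow> 'b::euclidean_space"
  assumes [measurable]: "V \<in> borel_measurable M" and zero: "expectation V = 0"
  shows "(\<integral>\<^sup>+\<omega>. ennreal ((norm (\<Sum>i<n. V (\<omega> i)))\<^sup>2) \<partial>PiM UNIV (\<lambda>_::nat. M))
    \<le> of_nat n * (\<integral>\<^sup>+x. ennreal ((norm (V x))\<^sup>2) \<partial>M)"
proof -
  interpret PP: prob_space "PiM UNIV (\<lambda>_::nat. M)" by (intro prob_space_PiM) unfold_locales
  show ?thesis
  proof (rule PP.nn_integral_norm_sum_square_le)
    show "PP.indep_vars (\<lambda>_. borel) (\<lambda>i \<omega>. V (\<omega> i)) UNIV"
      by (rule PP.indep_vars_compose2[OF indep_vars_coordinates]) auto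
    show "PP.expectation (\<lambda>\<omega>. V (\<omega> i)) = 0" for i by (simp add: integral_component zero)
    show "(\<integral>\<^sup>+\<omega>. ennreal ((norm (V (\<omega> i)))\<^sup>2) \<partial>PiM UNIV (\<lambda>_. M)) \<le> (\<integral>\<^sup>+x. ennreal ((norm (V x))\<^sup>2) \<partial>M)" for i
      by (subst nn_integral_component) auto
  qed
qed

lemma ennreal_le_of_power2_le: "x\<^sup>2 \<le> ennreal (c\<^sup>2) \<Longrightarrow> 0 \<le> c \<Longrightarrow> x \<le> ennreal c"
  by (cases x) (auto simp: ennreal_power power_eq_top_ennreal top_unique intro!: ennreal_leI power2_le_imp_le[of _ c])

lemma (in prob_space) expectation_between:
  fixes f :: "'a \<Rightarrow> real"
  assumes "integrable M f" "\<And>x. a \<le> f x" "\<And>x. f x \<le> b"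
  shows "a \<le> expectation f" "expectation f \<le> b"
  using assms by (auto intro!: integral_ge_const integral_le_const)

text \<open>In the application, up to a truncation of \<open>x\<close>, \<open>k x y\<close> is f(y
  - \<beta>0 \<bullet> x) and \<open>H x y\<close> is x f'(y - \<beta>0 \<bullet> x). The envelopes
  \<open>m\<close> and \<open>G\<close> bracket the kernel at each \<open>y\<close> for all
  \<open>x\<close>; \<open>q\<close> bounds \<open>norm (H x y) / k x y\<close>, a bound inherited
  by every ratio of averages. \<open>G_int\<close> yields a second moment for such ratios under the
  law of Y, \<open>H_zero\<close> records that f' has integral zero, and \<open>mass\<close> makes
  the average of \<open>k\<close> the density of that law.\<close>

locale two_sample_kernel = P: prob_space P for P :: "'x measure" +
  fixes k :: "'x \<Rightarrow> real \<Rightarrow> real" and H :: "'x \<Rightarrow> real \<Rightarrow> 'b::euclidean_space"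
    and m G q :: "real \<Rightarrow> real"
  assumes k_meas: "case_prod k \<in> borel_measurable (P \<Otimes>\<^sub>M borel)"
    and H_meas: "case_prod H \<in> borel_measurable (P \<Otimes>\<^sub>M borel)"
    and G_meas [measurable]: "G \<in> borel_measurable borel" and q_meas [measurable]: "q \<in> borel_measurable borel"
    and m_meas [measurable]: "m \<in> borel_measurable borel"
    and m_pos: "\<And>y. 0 < m y" and k_lower: "\<And>x y. m y \<le> k x y" and k_upper: "\<And>x y. k x y \<le> G y"
    and q_ge: "\<And>y. 1 \<le> q y" and H_bound: "\<And>x y. norm (H x y) \<le> q y * k x y"
    and G_int: "integrable lborel (\<lambda>y. (q y)\<^sup>2 * G y)"
    and H_zero: "\<And>x. (\<integral>y. H x y \<partial>lborel) = 0"
    and mass: "prob_space (density lborel (\<lambda>y. ennreal (\<integral>x. k x y \<partial>P)))"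
begin

section \<open>Bounds, means and integrability of the population quantities\<close>

lemma measurable_k [measurable (raw)]:
  "f \<in> measurable N P \<Longrightarrow> g \<in> borel_measurable N \<Longrightarrow> (\<lambda>z. k (f z) (g z)) \<in> borel_measurable N"
  using measurable_compose[OF measurable_Pair k_meas] by simp

lemma measurable_H [measurable (raw)]:
  "f \<in> measurable N P \<Longrightarrow> g \<in> borel_measurable N \<Longrightarrow> (\<lambda>z. H (f z) (g z)) \<in> borel_measurable N"
  using measurable_compose[OF measurable_Pair H_meas] by simp

definition fY :: "real \<Rightarrow> real" where "fY y = (\<integral>x. k x y \<partial>P)"
definition A :: "real \<Rightarrow> 'b" where "A y = (\<integral>x. H x y \<partial>P)"
definition r :: "real \<Rightarrow> 'b" where "r y = (1 / fY y) *\<^sub>R A y"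
definition h :: "'x \<Rightarrow> real \<Rightarrow> 'b" where "h x y = H x y - k x y *\<^sub>R r y"
definition \<psi> :: "'x \<Rightarrow> 'b" where "\<psi> x = - (\<integral>y. k x y *\<^sub>R r y \<partial>lborel)"
text \<open>The kernel of the degenerate U-statistic. Its mean in \<open>x\<close> under
  \<open>P\<close> is zero because \<open>h\<close> and \<open>\<psi>\<close> are centered; its mean
  in \<open>y\<close> under \<open>Q\<close> is zero because \<open>\<psi>\<close> is exactly the
  \<open>Q\<close>-mean of \<open>h\<close> divided by \<open>fY\<close>.\<close>

definition u :: "'x \<Rightarrow> real \<Rightarrow> 'b" where "u x y = (1 / fY y) *\<^sub>R h x y - \<psi> x"
definition Q :: "real measure" where "Q = density lborel (\<lambda>y. ennreal (fY y))"
abbreviation "PP \<equiv> PiM UNIV (\<lambda>_::nat. P)"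
abbreviation "QQ \<equiv> PiM UNIV (\<lambda>_::nat. Q)"

sublocale Q: prob_space Q unfolding Q_def fY_def by (rule mass)
sublocale PP: prob_space PP by (intro prob_space_PiM P.prob_space_axioms)
sublocale QQ: prob_space QQ by (intro prob_space_PiM Q.prob_space_axioms)
sublocale PL: pair_sigma_finite P lborel ..
sublocale PPL: pair_sigma_finite PP lborel ..
sublocale PPQ: pair_prob_space PP Q ..
sublocale PPQQ: pair_prob_space PP QQ ..

lemma sets_Q [measurable_cong, simp]: "sets Q = sets borel" by (simp add: Q_def)
lemma space_Q [simp]: "space Q = UNIV" by (simp add: Q_def)

lemma fY_meas [measurable]: "fY \<in> borel_measurable borel" unfolding fY_def by measurable
lemma A_meas [measurable]: "A \<in> borel_measurable borel" unfolding A_def by measurable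
lemma r_meas [measurable]: "r \<in> borel_measurable borel" unfolding r_def by measurable
lemma \<psi>_meas [measurable]: "\<psi> \<in> borel_measurable P" unfolding \<psi>_def by measurable
lemma h_meas [measurable (raw)]:
  assumes [measurable]: "f \<in> measurable N P" "g \<in> borel_measurable N"
  shows "(\<lambda>z. h (f z) (g z)) \<in> borel_measurable N"
  unfolding h_def by measurable
lemma u_meas [measurable (raw)]:
  assumes [measurable]: "f \<in> measurable N P" "g \<in> borel_measurable N"
  shows "(\<lambda>z. u (f z) (g z)) \<in> borel_measurable N"
  unfolding u_def by measurable

lemma k_pos: "0 < k x y" using m_pos k_lower by (rule order.strict_trans2)
lemma G_pos: "0 < G y" using k_pos k_upper by (rule order.strict_trans2)
lemma q_pos: "0 < q y" using q_ge[of y] by simp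

lemma k_int: "integrable P (\<lambda>x. k x y)"
  by (rule P.integrable_const_bound[where B="G y"]) (use k_pos k_upper in \<open>auto simp: less_imp_le\<close>)

lemma H_bound': "norm (H x y) \<le> q y * G y"
  using H_bound[of x y] mult_left_mono[OF k_upper[of x y], of "q y"] q_pos[of y] by linarith

lemma H_int: "integrable P (\<lambda>x. H x y)"
  by (rule P.integrable_const_bound[where B="q y * G y"]) (use H_bound' in auto)

lemma fY_lower: "m y \<le> fY y" and fY_upper: "fY y \<le> G y"
  unfolding fY_def by (rule P.expectation_between[OF k_int k_lower k_upper])+

lemma fY_pos: "0 < fY y" using m_pos fY_lower by (rule order.strict_trans2)

lemma norm_A_le: "norm (A y) \<le> q y * fY y"
proof -
  have "norm (A y) \<le> (\<integral>x. norm (H x y) \<partial>P)" unfolding A_def by (rule integral_norm_bound)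
  also have "\<dots> \<le> (\<integral>x. q y * k x y \<partial>P)"
    by (intro integral_mono) (use H_int k_int H_bound in auto)
  finally show ?thesis by (simp add: fY_def)
qed

text \<open>\<open>r\<close> is an average of the ratios of \<open>H x y\<close> to
  \<open>k x y\<close> with weights proportional to \<open>k x y\<close>, so it inherits their bound
  whatever the size of \<open>fY\<close>.\<close>

lemma norm_r_le: "norm (r y) \<le> q y"
  using norm_A_le[of y] fY_pos[of y] by (simp add: r_def divide_le_eq)

lemma norm_kr_le': "norm (k x y *\<^sub>R r y) \<le> q y * k x y"
  using norm_r_le[of y] k_pos[of x y] by (simp add: mult.commute mult_left_mono)

lemma norm_h_le: "norm (h x y) \<le> 2 * q y * k x y"
  unfolding h_def using norm_triangle_ineq4[of "H x y" "k x y *\<^sub>R r y"] norm_kr_le'[of x y] H_bound[of x y] by linarith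

lemma qk_le: "q y * k x y \<le> q y * G y"
  using k_upper q_pos by (simp add: less_imp_le mult_left_mono)

lemma norm_kr_le: "norm (k x y *\<^sub>R r y) \<le> q y * G y"
  using norm_kr_le'[of x y] qk_le[of y x] by linarith

lemma qG_le: "q y * G y \<le> (q y)\<^sup>2 * G y"
  using q_ge[of y] G_pos[of y] by (simp add: power2_eq_square)

lemma qG_int: "integrable lborel (\<lambda>y. q y * G y)"
  by (rule Bochner_Integration.integrable_bound[OF G_int]) (use qG_le G_pos q_pos in \<open>auto simp: less_imp_le abs_mult\<close>)

lemma lborel_integrable_dominated:
  fixes f :: "real \<Rightarrow> 'c::{banach, second_countable_topology}"
  assumes "f \<in> borel_measurable borel" "\<And>y. norm (f y) \<le> q y * G y"
  shows "integrable lborel f"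
  by (rule Bochner_Integration.integrable_bound[OF qG_int])
     (use assms in \<open>auto intro: order.trans[OF _ abs_ge_self]\<close>)

lemma kr_lborel: "x \<in> space P \<Longrightarrow> integrable lborel (\<lambda>y. k x y *\<^sub>R r y)"
  by (rule lborel_integrable_dominated) (simp, rule norm_kr_le)

lemma H_lborel: "x \<in> space P \<Longrightarrow> integrable lborel (H x)"
  by (rule lborel_integrable_dominated) (use H_bound' in auto)

lemma integral_h_P: "(\<integral>x. h x y \<partial>P) = 0"
proof -
  have "(\<integral>x. h x y \<partial>P) = A y - fY y *\<^sub>R r y"
    unfolding h_def A_def fY_def by (subst Bochner_Integration.integral_diff) (auto simp: H_int k_int)
  also have "\<dots> = 0" using fY_pos[of y] by (simp add: r_def)
  finally show ?thesis .
qed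

text \<open>This explains the minus sign in \<open>\<psi>\<close>: the \<open>H\<close> part of
  \<open>h\<close> integrates to zero and only the subtracted \<open>k x y *\<^sub>R r y\<close> is
  left.\<close>

lemma integral_h_lborel: "x \<in> space P \<Longrightarrow> (\<integral>y. h x y \<partial>lborel) = \<psi> x"
  unfolding h_def \<psi>_def by (simp add: H_lborel kr_lborel H_zero)

lemma norm_\<psi>_le: "norm (\<psi> x) \<le> (\<integral>y. q y * G y \<partial>lborel)"
proof -
  have "norm (\<psi> x) \<le> (\<integral>y. norm (k x y *\<^sub>R r y) \<partial>lborel)"
    unfolding \<psi>_def norm_minus_cancel by (rule integral_norm_bound)
  also have "\<dots> \<le> (\<integral>y. q y * G y \<partial>lborel)"
    by (rule integral_mono_AE') (auto intro!: AE_I2 qG_int norm_kr_le mult_nonneg_nonneg simp: q_pos G_pos less_imp_le simp del: norm_scaleR)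
  finally show ?thesis .
qed

lemma \<psi>_int: "integrable P \<psi>"
  by (rule P.integrable_const_bound[where B="\<integral>y. q y * G y \<partial>lborel"]) (use norm_\<psi>_le in auto)

lemma PL_integrable_dominated:
  fixes f :: "'x \<Rightarrow> real \<Rightarrow> 'c::{banach, second_countable_topology}"
  assumes [measurable]: "case_prod f \<in> borel_measurable (P \<Otimes>\<^sub>M borel)" and b: "\<And>x y. norm (f x y) \<le> q y * G y"
  shows "integrable (P \<Otimes>\<^sub>M lborel) (case_prod f)"
proof (rule integrableI_bounded)
  have "(\<integral>\<^sup>+p. ennreal (norm (case_prod f p)) \<partial>(P \<Otimes>\<^sub>M lborel)) = (\<integral>\<^sup>+x. (\<integral>\<^sup>+y. ennreal (norm (f x y)) \<partial>lborel) \<partial>P)"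
    by (subst lborel.nn_integral_fst[symmetric]) auto
  also have "\<dots> \<le> (\<integral>\<^sup>+x. (\<integral>\<^sup>+y. ennreal (q y * G y) \<partial>lborel) \<partial>P)"
    by (intro nn_integral_mono ennreal_leI b)
  also have "\<dots> = ennreal (\<integral>y. q y * G y \<partial>lborel)"
    using qG_int q_pos G_pos by (subst nn_integral_eq_integral) (auto simp: less_imp_le P.emeasure_space_1)
  finally show "(\<integral>\<^sup>+p. ennreal (norm (case_prod f p)) \<partial>(P \<Otimes>\<^sub>M lborel)) < \<infinity>"
    using order.strict_trans1 by fastforce
qed simp

lemma integral_A: "(\<integral>y. A y \<partial>lborel) = 0"
proof -
  have "(\<integral>y. A y \<partial>lborel) = (\<integral>x. (\<integral>y. H x y \<partial>lborel) \<partial>P)"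
    unfolding A_def using H_bound' H_meas by (intro PL.Fubini_integral PL_integrable_dominated)
  then show ?thesis by (simp add: H_zero)
qed

text \<open>By Fubini the mean of \<open>\<psi>\<close> is minus the integral of
  \<open>fY y *\<^sub>R r y = A y\<close>, and \<open>A\<close> inherits integral zero from
  \<open>H\<close>.\<close>

lemma integral_\<psi>: "(\<integral>x. \<psi> x \<partial>P) = 0"
proof -
  have "(\<integral>x. (\<integral>y. k x y *\<^sub>R r y \<partial>lborel) \<partial>P) = (\<integral>y. (\<integral>x. k x y *\<^sub>R r y \<partial>P) \<partial>lborel)"
    by (intro PL.Fubini_integral[symmetric] PL_integrable_dominated norm_kr_le) measurable
  also have "\<dots> = (\<integral>y. A y \<partial>lborel)"
    using fY_pos by (intro Bochner_Integration.integral_cong) (auto simp: r_def k_int fY_def[symmetric] less_imp_neq[symmetric])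
  finally show ?thesis unfolding \<psi>_def using integral_A by simp
qed

lemma integral_Q:
  fixes f :: "real \<Rightarrow> 'c::{banach, second_countable_topology}"
  assumes "f \<in> borel_measurable borel"
  shows "(\<integral>y. f y \<partial>Q) = (\<integral>y. fY y *\<^sub>R f y \<partial>lborel)"
  unfolding Q_def using assms fY_pos by (subst integral_density) (auto simp: less_imp_le)

lemma nn_integral_Q:
  assumes "f \<in> borel_measurable borel"
  shows "(\<integral>\<^sup>+y. f y \<partial>Q) = (\<integral>\<^sup>+y. ennreal (fY y) * f y \<partial>lborel)"
  unfolding Q_def using assms by (subst nn_integral_density) auto

lemma integral_r: "(\<integral>y. r y \<partial>Q) = 0"
  using fY_pos integral_A by (subst integral_Q) (auto simp: r_def less_imp_neq[symmetric])

lemma r_square_int: "integrable Q (\<lambda>y. (norm (r y))\<^sup>2)"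
proof (rule integrableI_bounded)
  have "(\<integral>\<^sup>+y. ennreal (norm ((norm (r y))\<^sup>2)) \<partial>Q) = (\<integral>\<^sup>+y. ennreal (fY y * (norm (r y))\<^sup>2) \<partial>lborel)"
    using fY_pos by (subst nn_integral_Q) (auto simp: ennreal_mult less_imp_le)
  also have "\<dots> \<le> (\<integral>\<^sup>+y. ennreal ((q y)\<^sup>2 * G y) \<partial>lborel)"
  proof (intro nn_integral_mono ennreal_leI)
    fix y
    have "fY y * (norm (r y))\<^sup>2 \<le> G y * (q y)\<^sup>2"
      using fY_upper norm_r_le fY_pos G_pos by (intro mult_mono power_mono) (auto simp: less_imp_le)
    then show "fY y * (norm (r y))\<^sup>2 \<le> (q y)\<^sup>2 * G y" by (simp add: mult.commute)
  qed
  also have "\<dots> < \<infinity>" using G_int G_pos by (subst nn_integral_eq_integral) (auto simp: less_imp_le)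
  finally show "(\<integral>\<^sup>+y. ennreal (norm ((norm (r y))\<^sup>2)) \<partial>Q) < \<infinity>" .
qed simp

section \<open>Second moment of the degenerate two-sample U-statistic\<close>

lemma integral_u_P: "(\<integral>x. u x y \<partial>P) = 0"
proof -
  have "integrable P (\<lambda>x. h x y)" unfolding h_def by (intro Bochner_Integration.integrable_diff H_int integrable_scaleR_left k_int)
  then show ?thesis unfolding u_def using integral_h_P integral_\<psi> \<psi>_int by simp
qed

lemma h_over_fY:
  assumes x: "x \<in> space P"
  shows "integrable Q (\<lambda>y. (1 / fY y) *\<^sub>R h x y)" "(\<integral>y. (1 / fY y) *\<^sub>R h x y \<partial>Q) = \<psi> x"
proof -
  have [measurable]: "h x \<in> borel_measurable borel" using x by measurable
  have eq: "fY y *\<^sub>R (1 / fY y) *\<^sub>R h x y = h x y" for y using fY_pos[of y] by simp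
  have "integrable lborel (h x)" unfolding h_def using H_lborel[OF x] kr_lborel[OF x] by auto
  then show "integrable Q (\<lambda>y. (1 / fY y) *\<^sub>R h x y)"
    unfolding Q_def using fY_pos by (subst integrable_density) (auto simp: less_imp_le eq simp del: scaleR_scaleR)
  show "(\<integral>y. (1 / fY y) *\<^sub>R h x y \<partial>Q) = \<psi> x"
    using integral_h_lborel[OF x] by (subst integral_Q) (auto simp: eq simp del: scaleR_scaleR)
qed

lemma integral_u_Q: "x \<in> space P \<Longrightarrow> integrable Q (u x) \<and> (\<integral>y. u x y \<partial>Q) = 0"
  unfolding u_def using h_over_fY[of x] Q.prob_space by simp

text \<open>In the square of \<open>k x y / fY y\<close> one factor \<open>k\<close> is bounded by
  \<open>G\<close> and the other averages to \<open>fY\<close> over \<open>P\<close>. This cancels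
  one \<open>fY\<close> of the denominator, the density of \<open>Q\<close> cancels the other, and a
  multiple of the integrable \<open>(q y)\<^sup>2 * G y\<close> remains. Bounding both factors by
  \<open>G\<close> would leave an uncontrolled factor \<open>G y / fY y\<close>.\<close>

lemma u_square_finite: "(\<integral>\<^sup>+y. (\<integral>\<^sup>+x. ennreal ((norm (u x y))\<^sup>2) \<partial>P) \<partial>Q) < \<infinity>"
proof -
  define C where "C = (\<integral>y. q y * G y \<partial>lborel)"
  have pt: "(norm (u x y))\<^sup>2 \<le> (8 * (q y)\<^sup>2 * G y / (fY y)\<^sup>2) * k x y + 2 * C\<^sup>2" for x y
  proof -
    have "norm (u x y) \<le> norm ((1 / fY y) *\<^sub>R h x y) + norm (\<psi> x)" unfolding u_def by (rule norm_triangle_ineq4)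
    also have "\<dots> \<le> 2 * q y * k x y / fY y + C"
      using norm_h_le[of x y] norm_\<psi>_le[of x] fY_pos[of y] by (intro add_mono) (auto simp: C_def intro: divide_right_mono)
    finally have "(norm (u x y))\<^sup>2 \<le> (2 * q y * k x y / fY y + C)\<^sup>2" by (intro power_mono) auto
    also have "\<dots> \<le> 2 * (2 * q y * k x y / fY y)\<^sup>2 + 2 * C\<^sup>2"
      using sum_squares_bound[of "2 * q y * k x y / fY y" C] by (simp add: power2_sum)
    also have "(2 * q y * k x y / fY y)\<^sup>2 = (4 * (q y)\<^sup>2 / (fY y)\<^sup>2) * k x y * k x y"
      by (simp add: power2_eq_square)
    also have "2 * \<dots> \<le> (8 * (q y)\<^sup>2 / (fY y)\<^sup>2) * k x y * G y"
    proof -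
      have "(8 * (q y)\<^sup>2 / (fY y)\<^sup>2) * k x y * k x y \<le> (8 * (q y)\<^sup>2 / (fY y)\<^sup>2) * k x y * G y"
        using k_upper[of x y] k_pos[of x y] by (intro mult_left_mono) auto
      then show ?thesis by simp
    qed
    finally show ?thesis by (simp add: mult_ac)
  qed
  have inner: "(\<integral>\<^sup>+x. ennreal ((norm (u x y))\<^sup>2) \<partial>P) \<le> ennreal (8 * (q y)\<^sup>2 * G y / fY y) + ennreal (2 * C\<^sup>2)" for y
  proof -
    let ?c = "8 * (q y)\<^sup>2 * G y / (fY y)\<^sup>2"
    have "(\<integral>\<^sup>+x. ennreal ((norm (u x y))\<^sup>2) \<partial>P) \<le> (\<integral>\<^sup>+x. ennreal (?c * k x y + 2 * C\<^sup>2) \<partial>P)"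
      by (intro nn_integral_mono ennreal_leI pt)
    also have "\<dots> = ennreal (\<integral>x. ?c * k x y + 2 * C\<^sup>2 \<partial>P)"
      using G_pos k_pos by (intro nn_integral_eq_integral) (auto simp: k_int less_imp_le intro!: AE_I2 add_nonneg_nonneg mult_nonneg_nonneg divide_nonneg_nonneg)
    also have "(\<integral>x. ?c * k x y + 2 * C\<^sup>2 \<partial>P) = ?c * fY y + 2 * C\<^sup>2"
      by (simp add: k_int fY_def P.prob_space)
    also have "?c * fY y = 8 * (q y)\<^sup>2 * G y / fY y" by (simp add: power2_eq_square)
    finally show ?thesis using G_pos[of y] fY_pos[of y] by (simp add: ennreal_plus)
  qed
  have "(\<integral>\<^sup>+y. (\<integral>\<^sup>+x. ennreal ((norm (u x y))\<^sup>2) \<partial>P) \<partial>Q) \<le> (\<integral>\<^sup>+y. ennreal (8 * (q y)\<^sup>2 * G y / fY y) + ennreal (2 * C\<^sup>2) \<partial>Q)"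
    by (intro nn_integral_mono inner)
  also have "\<dots> = (\<integral>\<^sup>+y. ennreal (8 * (q y)\<^sup>2 * G y / fY y) \<partial>Q) + ennreal (2 * C\<^sup>2)"
    using Q.emeasure_space_1 by (subst nn_integral_add) auto
  also have "(\<integral>\<^sup>+y. ennreal (8 * (q y)\<^sup>2 * G y / fY y) \<partial>Q) = (\<integral>\<^sup>+y. ennreal (8 * ((q y)\<^sup>2 * G y)) \<partial>lborel)"
    using fY_pos G_pos by (subst nn_integral_Q) (auto simp: ennreal_mult[symmetric] less_imp_le less_imp_neq[symmetric] mult_ac intro!: nn_integral_cong)
  also have "\<dots> = ennreal (\<integral>y. 8 * ((q y)\<^sup>2 * G y) \<partial>lborel)"
    using G_int G_pos by (intro nn_integral_eq_integral) (auto simp: less_imp_le)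
  also have "\<dots> + ennreal (2 * C\<^sup>2) < \<infinity>" by simp
  finally show ?thesis .
qed

definition u_energy :: ennreal where
  "u_energy = (\<integral>\<^sup>+y. (\<integral>\<^sup>+x. ennreal ((norm (u x y))\<^sup>2) \<partial>P) \<partial>Q)"

text \<open>Orthogonality is used one variable at a time: for frozen \<open>xs\<close> the summands
  over \<open>j\<close> are independent and centered, and after exchanging the integrals so are
  those over \<open>i\<close> for frozen \<open>y\<close>. Each step costs a factor \<open>n\<close>
  in place of \<open>n\<^sup>2\<close>.\<close>

lemma nn_integral_U_le:
  "(\<integral>\<^sup>+xs. (\<integral>\<^sup>+ys. ennreal ((norm (\<Sum>j<n. \<Sum>i<n. u (xs i) (ys j)))\<^sup>2) \<partial>QQ) \<partial>PP) \<le> of_nat n * (of_nat n * u_energy)"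
proof -
  have "(\<integral>\<^sup>+ys. ennreal ((norm (\<Sum>j<n. \<Sum>i<n. u (xs i) (ys j)))\<^sup>2) \<partial>QQ)
    \<le> of_nat n * (\<integral>\<^sup>+y. ennreal ((norm (\<Sum>i<n. u (xs i) y))\<^sup>2) \<partial>Q)" if "xs \<in> space PP" for xs
  proof (rule Q.nn_integral_iid_sum_square_le)
    have [measurable]: "xs i \<in> space P" for i using that by (auto simp: space_PiM)
    show "(\<lambda>y. \<Sum>i<n. u (xs i) y) \<in> borel_measurable Q" by measurable
    show "(\<integral>y. (\<Sum>i<n. u (xs i) y) \<partial>Q) = 0"
      using integral_u_Q[OF \<open>xs _ \<in> space P\<close>] by (subst Bochner_Integration.integral_sum) auto
  qed
  then have "(\<integral>\<^sup>+xs. (\<integral>\<^sup>+ys. ennreal ((norm (\<Sum>j<n. \<Sum>i<n. u (xs i) (ys j)))\<^sup>2) \<partial>QQ) \<partial>PP)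
    \<le> (\<integral>\<^sup>+xs. of_nat n * (\<integral>\<^sup>+y. ennreal ((norm (\<Sum>i<n. u (xs i) y))\<^sup>2) \<partial>Q) \<partial>PP)"
    by (rule nn_integral_mono)
  also have "\<dots> = of_nat n * (\<integral>\<^sup>+xs. (\<integral>\<^sup>+y. ennreal ((norm (\<Sum>i<n. u (xs i) y))\<^sup>2) \<partial>Q) \<partial>PP)"
    by (rule nn_integral_cmult) measurable
  also have "(\<integral>\<^sup>+xs. (\<integral>\<^sup>+y. ennreal ((norm (\<Sum>i<n. u (xs i) y))\<^sup>2) \<partial>Q) \<partial>PP)
    = (\<integral>\<^sup>+y. (\<integral>\<^sup>+xs. ennreal ((norm (\<Sum>i<n. u (xs i) y))\<^sup>2) \<partial>PP) \<partial>Q)"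
    by (rule PPQ.Fubini'[symmetric]) measurable
  also have "\<dots> \<le> (\<integral>\<^sup>+y. of_nat n * (\<integral>\<^sup>+x. ennreal ((norm (u x y))\<^sup>2) \<partial>P) \<partial>Q)"
    by (intro nn_integral_mono P.nn_integral_iid_sum_square_le integral_u_P) measurable
  also have "\<dots> = of_nat n * u_energy" unfolding u_energy_def by (rule nn_integral_cmult) measurable
  finally show ?thesis by (simp add: mult_left_mono)
qed

section \<open>The empirical ratio and its product remainder\<close>

definition D :: "nat \<Rightarrow> (nat \<Rightarrow> 'x) \<Rightarrow> real \<Rightarrow> real" where
  "D n xs y = (1 / real n) * (\<Sum>i<n. k (xs i) y)"
definition rn :: "nat \<Rightarrow> (nat \<Rightarrow> 'x) \<Rightarrow> real \<Rightarrow> 'b" where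
  "rn n xs y = ((1 / real n) *\<^sub>R (\<Sum>i<n. H (xs i) y)) /\<^sub>R D n xs y"
definition R :: "nat \<Rightarrow> (nat \<Rightarrow> 'x) \<Rightarrow> real \<Rightarrow> 'b" where
  "R n xs y = ((fY y - D n xs y) / fY y) *\<^sub>R (rn n xs y - r y)"

lemma D_meas [measurable (raw)]:
  assumes [measurable]: "\<And>i. (\<lambda>z. f z i) \<in> measurable N P" "g \<in> borel_measurable N"
  shows "(\<lambda>z. D n (f z) (g z)) \<in> borel_measurable N"
  unfolding D_def by measurable
lemma rn_meas [measurable (raw)]:
  assumes [measurable]: "\<And>i. (\<lambda>z. f z i) \<in> measurable N P" "g \<in> borel_measurable N"
  shows "(\<lambda>z. rn n (f z) (g z)) \<in> borel_measurable N"
  unfolding rn_def by measurable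
lemma R_meas [measurable (raw)]:
  assumes [measurable]: "\<And>i. (\<lambda>z. f z i) \<in> measurable N P" "g \<in> borel_measurable N"
  shows "(\<lambda>z. R n (f z) (g z)) \<in> borel_measurable N"
  unfolding R_def by measurable

lemma D_lower: "n > 0 \<Longrightarrow> m y \<le> D n xs y"
  using sum_bounded_below[of "{..<n}" "m y" "\<lambda>i. k (xs i) y"] k_lower by (simp add: D_def field_simps)

lemma D_pos: "n > 0 \<Longrightarrow> 0 < D n xs y" using D_lower m_pos by (rule order.strict_trans2[rotated])

lemma norm_rn_le: "n > 0 \<Longrightarrow> norm (rn n xs y) \<le> q y"
proof -
  assume n: "n > 0"
  have "norm (\<Sum>i<n. H (xs i) y) \<le> (\<Sum>i<n. q y * k (xs i) y)" by (rule sum_norm_le) (rule H_bound)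
  then have "norm ((1 / real n) *\<^sub>R (\<Sum>i<n. H (xs i) y)) \<le> q y * D n xs y"
    using n by (simp add: D_def sum_distrib_left[symmetric] divide_right_mono)
  then show ?thesis using D_pos[OF n, of xs y] unfolding rn_def norm_scaleR[of "inverse (D n xs y)"]
    by (simp add: inverse_eq_divide pos_divide_le_eq del: norm_scaleR)
qed

lemma rn_diff: "n > 0 \<Longrightarrow> rn n xs y - r y = ((1 / real n) *\<^sub>R (\<Sum>i<n. h (xs i) y)) /\<^sub>R D n xs y"
proof -
  assume n: "n > 0"
  have "(1 / real n) *\<^sub>R (\<Sum>i<n. h (xs i) y) = (1 / real n) *\<^sub>R (\<Sum>i<n. H (xs i) y) - D n xs y *\<^sub>R r y"
    by (simp add: h_def sum_subtractf D_def scaleR_sum_left[symmetric] algebra_simps)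
  then show ?thesis using D_pos[OF n, of xs y] by (simp add: rn_def scaleR_right_diff_distrib)
qed

text \<open>An exact identity: \<open>rn - r\<close> is split by
  \<open>1 = D / fY + (fY - D) / fY\<close>, and the first part replaces the random denominator of
  \<open>rn_diff\<close> by \<open>fY\<close>.\<close>

lemma rn_expansion:
  assumes n: "n > 0"
  shows "rn n xs y - r y = (1 / real n) *\<^sub>R (\<Sum>i<n. u (xs i) y) + (1 / real n) *\<^sub>R (\<Sum>i<n. \<psi> (xs i)) + R n xs y"
proof -
  let ?a = "(1 / real n) *\<^sub>R (\<Sum>i<n. h (xs i) y)"
  have "?a = D n xs y *\<^sub>R (rn n xs y - r y)" using D_pos[OF n, of xs y] by (simp add: rn_diff[OF n])
  then have "(1 / fY y) *\<^sub>R ?a + R n xs y = (D n xs y / fY y + (fY y - D n xs y) / fY y) *\<^sub>R (rn n xs y - r y)"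
    unfolding scaleR_left.add by (simp add: R_def)
  also have "D n xs y / fY y + (fY y - D n xs y) / fY y = 1" using fY_pos[of y] by (simp add: field_simps)
  finally have "rn n xs y - r y = (1 / fY y) *\<^sub>R ?a + R n xs y" by simp
  moreover have "(1 / fY y) *\<^sub>R ?a = (1 / real n) *\<^sub>R (\<Sum>i<n. u (xs i) y + \<psi> (xs i))"
    by (simp add: u_def scaleR_sum_right mult.commute)
  ultimately show ?thesis by (simp add: sum.distrib scaleR_right_distrib)
qed

text \<open>The smaller of the trivial bound and the rate of a centered average over the lower
  envelope of the denominator. It tends to zero at each \<open>y\<close>, possibly not uniformly
  since \<open>G / m\<close> may be unbounded; the cap 1 is what allows dominated
  convergence.\<close>

definition w :: "nat \<Rightarrow> real \<Rightarrow> real" where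
  "w n y = min 1 (G y / (sqrt (real n) * m y))"

lemma w_meas [measurable]: "w n \<in> borel_measurable borel" unfolding w_def[abs_def] by measurable

lemma w_nonneg: "0 \<le> w n y" using G_pos[of y] m_pos[of y] by (simp add: w_def)

lemma nn_integral_D_diff_square_le:
  assumes n: "n > 0"
  shows "(\<integral>\<^sup>+xs. ennreal ((fY y - D n xs y)\<^sup>2) \<partial>PP) \<le> ennreal ((G y)\<^sup>2 / n)"
proof -
  have "(fY y - D n xs y)\<^sup>2 = (1 / (real n)\<^sup>2) * (norm (\<Sum>i<n. k (xs i) y - fY y))\<^sup>2" for xs
  proof -
    have "fY y - D n xs y = - (1 / real n) * (\<Sum>i<n. k (xs i) y - fY y)"
      using n by (simp add: D_def sum_subtractf field_simps)
    then show ?thesis by (simp add: power_mult_distrib power_divide)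
  qed
  then have "(\<integral>\<^sup>+xs. ennreal ((fY y - D n xs y)\<^sup>2) \<partial>PP)
      = ennreal (1 / (real n)\<^sup>2) * (\<integral>\<^sup>+xs. ennreal ((norm (\<Sum>i<n. k (xs i) y - fY y))\<^sup>2) \<partial>PP)"
    by (subst nn_integral_cmult[symmetric]) (auto simp: ennreal_mult[symmetric])
  also have "\<dots> \<le> ennreal (1 / (real n)\<^sup>2) * (of_nat n * (\<integral>\<^sup>+x. ennreal ((norm (k x y - fY y))\<^sup>2) \<partial>P))"
    by (intro mult_left_mono P.nn_integral_iid_sum_square_le) (auto simp: k_int P.prob_space fY_def)
  also have "\<dots> \<le> ennreal (1 / (real n)\<^sup>2) * (of_nat n * (\<integral>\<^sup>+x. ennreal ((G y)\<^sup>2) \<partial>P))"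
  proof (intro mult_left_mono nn_integral_mono ennreal_leI power_mono)
    fix x show "norm (k x y - fY y) \<le> G y"
      using k_pos[of x y] k_upper[of x y] fY_pos[of y] fY_upper[of y] by (auto simp: abs_le_iff)
  qed auto
  also have "\<dots> = ennreal ((G y)\<^sup>2 / n)"
    using n by (simp add: P.emeasure_space_1 ennreal_of_nat_eq_real_of_nat ennreal_mult[symmetric] power2_eq_square)
  finally show ?thesis .
qed

text \<open>Where the cap in \<open>w\<close> is active, both ratios are bounded by
  \<open>q\<close>. Elsewhere \<open>D\<close> is at least \<open>m\<close>, and the numerator is a
  centered average of \<open>h\<close> with mean square of order
  \<open>(q y * G y)\<^sup>2 / n\<close>.\<close>

lemma nn_integral_rn_diff_square_le:
  assumes n: "n > 0"
  shows "(\<integral>\<^sup>+xs. ennreal ((norm (rn n xs y - r y))\<^sup>2) \<partial>PP) \<le> ennreal ((2 * q y * w n y)\<^sup>2)"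
proof (cases "G y / (sqrt (real n) * m y) \<le> 1")
  case False
  have "(\<integral>\<^sup>+xs. ennreal ((norm (rn n xs y - r y))\<^sup>2) \<partial>PP) \<le> (\<integral>\<^sup>+xs. ennreal ((2 * q y)\<^sup>2) \<partial>PP)"
  proof (intro nn_integral_mono ennreal_leI power_mono)
    fix xs show "norm (rn n xs y - r y) \<le> 2 * q y"
      using norm_triangle_ineq4[of "rn n xs y" "r y"] norm_rn_le[OF n, of xs y] norm_r_le[of y] by linarith
  qed auto
  also have "\<dots> = ennreal ((2 * q y * w n y)\<^sup>2)" using False by (simp add: PP.emeasure_space_1 w_def)
  finally show ?thesis .
next
  case True
  define c where "c = 1 / ((real n)\<^sup>2 * (m y)\<^sup>2)"
  have c: "c \<ge> 0" by (simp add: c_def)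
  have "(norm (rn n xs y - r y))\<^sup>2 \<le> c * (norm (\<Sum>i<n. h (xs i) y))\<^sup>2" for xs
  proof -
    have "norm (rn n xs y - r y) = (1 / real n) * norm (\<Sum>i<n. h (xs i) y) / D n xs y"
      using D_pos[OF n, of xs y] by (simp add: rn_diff[OF n] divide_inverse mult_ac)
    also have "\<dots> \<le> (1 / real n) * norm (\<Sum>i<n. h (xs i) y) / m y"
      using D_lower[OF n, of y xs] m_pos[of y] by (intro divide_left_mono) auto
    finally have "(norm (rn n xs y - r y))\<^sup>2 \<le> ((1 / real n) * norm (\<Sum>i<n. h (xs i) y) / m y)\<^sup>2"
      by (rule power_mono) simp
    then show ?thesis by (simp add: c_def power_mult_distrib power_divide)
  qed
  then have "(\<integral>\<^sup>+xs. ennreal ((norm (rn n xs y - r y))\<^sup>2) \<partial>PP) \<le> (\<integral>\<^sup>+xs. ennreal (c * (norm (\<Sum>i<n. h (xs i) y))\<^sup>2) \<partial>PP)"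
    by (intro nn_integral_mono ennreal_leI)
  also have "\<dots> = ennreal c * (\<integral>\<^sup>+xs. ennreal ((norm (\<Sum>i<n. h (xs i) y))\<^sup>2) \<partial>PP)"
    using c by (subst nn_integral_cmult[symmetric]) (auto simp: ennreal_mult)
  also have "\<dots> \<le> ennreal c * (of_nat n * (\<integral>\<^sup>+x. ennreal ((norm (h x y))\<^sup>2) \<partial>P))"
    by (intro mult_left_mono P.nn_integral_iid_sum_square_le integral_h_P) auto
  also have "\<dots> \<le> ennreal c * (of_nat n * (\<integral>\<^sup>+x. ennreal ((2 * q y * G y)\<^sup>2) \<partial>P))"
  proof (intro mult_left_mono nn_integral_mono ennreal_leI power_mono)
    fix x show "norm (h x y) \<le> 2 * q y * G y"
      using norm_h_le[of x y] qk_le[of y x] by linarith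
  qed auto
  also have "\<dots> = ennreal (c * (n * (2 * q y * G y)\<^sup>2))"
    using c by (simp add: P.emeasure_space_1 ennreal_of_nat_eq_real_of_nat ennreal_mult)
  also have "c * (n * (2 * q y * G y)\<^sup>2) = (2 * q y * w n y)\<^sup>2"
    using True n m_pos[of y] by (simp add: c_def w_def power_mult_distrib power_divide power2_eq_square[of "real n"])
  finally show ?thesis .
qed

text \<open>Cauchy-Schwarz over the sample: the deviation of \<open>D\<close> supplies
  \<open>G y / sqrt n\<close>, which uses up the factor \<open>sqrt n\<close> entirely, and the
  deviation of \<open>rn\<close> supplies the factor \<open>w n y\<close> that still tends to
  zero.\<close>

lemma nn_integral_R_le:
  assumes n: "n > 0"
  shows "(\<integral>\<^sup>+xs. ennreal (sqrt n * (\<bar>fY y - D n xs y\<bar> * norm (rn n xs y - r y))) \<partial>PP) \<le> ennreal (2 * (q y * G y) * w n y)"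
proof -
  let ?I = "\<integral>\<^sup>+xs. ennreal \<bar>fY y - D n xs y\<bar> * ennreal (norm (rn n xs y - r y)) \<partial>PP"
  have "?I\<^sup>2 \<le> (\<integral>\<^sup>+xs. (ennreal \<bar>fY y - D n xs y\<bar>)\<^sup>2 \<partial>PP) * (\<integral>\<^sup>+xs. (ennreal (norm (rn n xs y - r y)))\<^sup>2 \<partial>PP)"
    by (rule Cauchy_Schwarz_nn_integral) measurable
  also have "\<dots> \<le> ennreal ((G y)\<^sup>2 / n) * ennreal ((2 * q y * w n y)\<^sup>2)"
    using nn_integral_D_diff_square_le[OF n, of y] nn_integral_rn_diff_square_le[OF n, of y]
    by (intro mult_mono) (auto simp: ennreal_power)
  also have "\<dots> = ennreal ((2 * (q y * G y) * w n y / sqrt n)\<^sup>2)"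
    by (simp add: ennreal_mult[symmetric] power_mult_distrib power_divide mult_ac)
  finally have "?I \<le> ennreal (2 * (q y * G y) * w n y / sqrt n)"
    by (rule ennreal_le_of_power2_le) (simp add: q_pos G_pos w_nonneg less_imp_le)
  then have "ennreal (sqrt n) * ?I \<le> ennreal (sqrt n) * ennreal (2 * (q y * G y) * w n y / sqrt n)"
    by (rule mult_left_mono) simp
  also have "\<dots> = ennreal (2 * (q y * G y) * w n y)"
    using n by (simp add: ennreal_mult'[symmetric])
  also have "ennreal (sqrt n) * ?I = (\<integral>\<^sup>+xs. ennreal (sqrt n * (\<bar>fY y - D n xs y\<bar> * norm (rn n xs y - r y))) \<partial>PP)"
    by (subst nn_integral_cmult[symmetric]) (auto simp: ennreal_mult)
  finally show ?thesis .
qed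

definition R_energy :: "nat \<Rightarrow> real" where
  "R_energy n = (\<integral>y. 2 * (q y * G y) * w n y \<partial>lborel)"

lemma R_energy_integrable: "integrable lborel (\<lambda>y. 2 * (q y * G y) * w n y)"
proof (rule Bochner_Integration.integrable_bound)
  show "integrable lborel (\<lambda>y. 2 * (q y * G y))" using qG_int by simp
  show "AE y in lborel. norm (2 * (q y * G y) * w n y) \<le> norm (2 * (q y * G y))"
    using w_nonneg[of n] q_pos G_pos by (auto simp: abs_mult mult_left_le less_imp_le w_def)
qed simp

lemma R_energy_tendsto: "R_energy \<longlonglongrightarrow> 0"
proof -
  have "(\<lambda>n. \<integral>y. 2 * (q y * G y) * w n y \<partial>lborel) \<longlonglongrightarrow> (\<integral>y. 2 * (q y * G y) * 0 \<partial>lborel)"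
  proof (rule integral_dominated_convergence)
    show "integrable lborel (\<lambda>y. 2 * (q y * G y))" using qG_int by simp
    show "AE y in lborel. (\<lambda>n. 2 * (q y * G y) * w n y) \<longlonglongrightarrow> 2 * (q y * G y) * 0"
    proof (intro AE_I2 tendsto_mult_left)
      fix y
      have "(\<lambda>n. G y / (sqrt (real n) * m y)) \<longlonglongrightarrow> 0"
        using m_pos[of y] by real_asymp
      then have "(\<lambda>n. min 1 (G y / (sqrt (real n) * m y))) \<longlonglongrightarrow> min 1 0" by (intro tendsto_min tendsto_const)
      then show "(\<lambda>n. w n y) \<longlonglongrightarrow> 0" by (simp add: w_def)
    qed
    show "AE y in lborel. norm (2 * (q y * G y) * w n y) \<le> 2 * (q y * G y)" for n
      using w_nonneg[of n] q_pos G_pos by (auto simp: abs_mult mult_left_le less_imp_le w_def)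
  qed auto
  then show ?thesis by (simp add: R_energy_def[abs_def])
qed

text \<open>A first absolute moment suffices here, so the dependence of the summands through the
  common \<open>xs\<close> is harmless: by linearity the average over \<open>j\<close> has the mean
  of a single summand.\<close>

lemma nn_integral_R_sum_le:
  assumes n: "n > 0"
  shows "(\<integral>\<^sup>+xs. (\<integral>\<^sup>+ys. ennreal (sqrt n * ((1 / n) * (\<Sum>j<n. norm (R n xs (ys j))))) \<partial>QQ) \<partial>PP) \<le> ennreal (R_energy n)"
proof -
  have "(\<integral>\<^sup>+ys. ennreal (sqrt n * ((1 / n) * (\<Sum>j<n. norm (R n xs (ys j))))) \<partial>QQ)
     = (\<integral>\<^sup>+y. ennreal (sqrt n * (\<bar>fY y - D n xs y\<bar> * norm (rn n xs y - r y))) \<partial>lborel)" if xs: "xs \<in> space PP" for xs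
  proof -
    have [measurable]: "xs i \<in> space P" for i using xs by (auto simp: space_PiM)
    have norm_R: "norm (R n xs y) = \<bar>fY y - D n xs y\<bar> / fY y * norm (rn n xs y - r y)" for y
      unfolding R_def norm_scaleR using fY_pos[of y] by simp
    have "(\<integral>\<^sup>+ys. ennreal (sqrt n * ((1 / n) * (\<Sum>j<n. norm (R n xs (ys j))))) \<partial>QQ)
      = (\<integral>\<^sup>+ys. ennreal (1 / n) * (\<Sum>j<n. ennreal (sqrt n * norm (R n xs (ys j)))) \<partial>QQ)"
      by (intro nn_integral_cong) (simp add: sum_nonneg ennreal_mult[symmetric] sum_distrib_left[symmetric] mult_ac)
    also have "\<dots> = ennreal (1 / n) * (\<Sum>j<n. \<integral>\<^sup>+ys. ennreal (sqrt n * norm (R n xs (ys j))) \<partial>QQ)"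
      by (subst nn_integral_cmult, measurable, subst nn_integral_sum) auto
    also have "\<dots> = ennreal (1 / n) * (\<Sum>j<n. \<integral>\<^sup>+y. ennreal (sqrt n * norm (R n xs y)) \<partial>Q)"
      by (subst Q.nn_integral_component) auto
    also have "\<dots> = (\<integral>\<^sup>+y. ennreal (sqrt n * norm (R n xs y)) \<partial>Q)"
      using n by (simp add: ennreal_of_nat_eq_real_of_nat mult.assoc[symmetric] ennreal_mult[symmetric])
    also have "\<dots> = (\<integral>\<^sup>+y. ennreal (fY y) * ennreal (sqrt n * norm (R n xs y)) \<partial>lborel)"
      by (rule nn_integral_Q) measurable
    also have "\<dots> = (\<integral>\<^sup>+y. ennreal (sqrt n * (\<bar>fY y - D n xs y\<bar> * norm (rn n xs y - r y))) \<partial>lborel)"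
    proof (intro nn_integral_cong)
      fix y
      show "ennreal (fY y) * ennreal (sqrt n * norm (R n xs y)) = ennreal (sqrt n * (\<bar>fY y - D n xs y\<bar> * norm (rn n xs y - r y)))"
        using fY_pos[of y] by (subst ennreal_mult[symmetric]) (auto simp: norm_R)
    qed
    finally show ?thesis .
  qed
  then have "(\<integral>\<^sup>+xs. (\<integral>\<^sup>+ys. ennreal (sqrt n * ((1 / n) * (\<Sum>j<n. norm (R n xs (ys j))))) \<partial>QQ) \<partial>PP)
    = (\<integral>\<^sup>+xs. (\<integral>\<^sup>+y. ennreal (sqrt n * (\<bar>fY y - D n xs y\<bar> * norm (rn n xs y - r y))) \<partial>lborel) \<partial>PP)"
    by (rule nn_integral_cong)
  also have "\<dots> = (\<integral>\<^sup>+y. (\<integral>\<^sup>+xs. ennreal (sqrt n * (\<bar>fY y - D n xs y\<bar> * norm (rn n xs y - r y))) \<partial>PP) \<partial>lborel)"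
    by (rule PPL.Fubini'[symmetric]) measurable
  also have "\<dots> \<le> (\<integral>\<^sup>+y. ennreal (2 * (q y * G y) * w n y) \<partial>lborel)"
    by (intro nn_integral_mono nn_integral_R_le n)
  also have "\<dots> = ennreal (R_energy n)" unfolding R_energy_def
    by (intro nn_integral_eq_integral R_energy_integrable) (simp add: q_pos G_pos w_nonneg less_imp_le)
  finally show ?thesis .
qed

section \<open>The expansion in probability\<close>

definition S :: "nat \<Rightarrow> (nat \<Rightarrow> 'x) \<Rightarrow> (nat \<Rightarrow> real) \<Rightarrow> 'b" where
  "S n xs ys = (1 / real n) *\<^sub>R (\<Sum>j<n. rn n xs (ys j))"
definition T1 :: "nat \<Rightarrow> (nat \<Rightarrow> real) \<Rightarrow> 'b" where
  "T1 n ys = (1 / real n) *\<^sub>R (\<Sum>j<n. r (ys j))"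
definition T2 :: "nat \<Rightarrow> (nat \<Rightarrow> 'x) \<Rightarrow> 'b" where
  "T2 n xs = (1 / real n) *\<^sub>R (\<Sum>i<n. \<psi> (xs i))"

lemma expansion:
  assumes n: "n > 0"
  shows "S n xs ys - T1 n ys - T2 n xs
    = (1 / (real n)\<^sup>2) *\<^sub>R (\<Sum>j<n. \<Sum>i<n. u (xs i) (ys j)) + (1 / real n) *\<^sub>R (\<Sum>j<n. R n xs (ys j))"
proof -
  have "S n xs ys - T1 n ys = (1 / real n) *\<^sub>R (\<Sum>j<n. rn n xs (ys j) - r (ys j))"
    by (simp add: S_def T1_def sum_subtractf scaleR_right_diff_distrib)
  also have "\<dots> = (1 / real n) *\<^sub>R (\<Sum>j<n. (1 / real n) *\<^sub>R (\<Sum>i<n. u (xs i) (ys j)) + T2 n xs + R n xs (ys j))"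
    by (simp add: rn_expansion[OF n] T2_def)
  also have "\<dots> = (1 / (real n)\<^sup>2) *\<^sub>R (\<Sum>j<n. \<Sum>i<n. u (xs i) (ys j)) + T2 n xs + (1 / real n) *\<^sub>R (\<Sum>j<n. R n xs (ys j))"
    using n by (simp add: sum.distrib scaleR_right_distrib scaleR_sum_right[symmetric] power2_eq_square sum_constant_scaleR)
  finally show ?thesis by simp
qed

theorem expansion_in_probability:
  assumes e: "e > 0"
  shows "(\<lambda>n. measure (PP \<Otimes>\<^sub>M QQ) {p \<in> space (PP \<Otimes>\<^sub>M QQ).
     sqrt (real n) * norm (S n (fst p) (snd p) - T1 n (snd p) - T2 n (fst p)) > e}) \<longlonglongrightarrow> 0"
proof -
  define K where "K = enn2real u_energy"
  have K: "u_energy = ennreal K" using u_square_finite by (simp add: K_def u_energy_def)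
  have K0: "K \<ge> 0" by (simp add: K_def)
  have R0: "R_energy n \<ge> 0" for n unfolding R_energy_def
    by (intro integral_nonneg_AE) (simp add: q_pos G_pos w_nonneg less_imp_le)
  let ?E = "\<lambda>n. {p \<in> space (PP \<Otimes>\<^sub>M QQ). sqrt (real n) * norm (S n (fst p) (snd p) - T1 n (snd p) - T2 n (fst p)) > e}"
  have bound: "measure (PP \<Otimes>\<^sub>M QQ) (?E n) \<le> 4 / e\<^sup>2 * (K / n) + 2 / e * R_energy n" if n: "n > 0" for n
  proof -
    let ?\<Omega> = "space (PP \<Otimes>\<^sub>M QQ)"
    \<comment> \<open>The threshold \<open>e\<close> is split into halves: Chebyshev's inequality
      for the U-statistic gives the factor \<open>4 / e\<^sup>2\<close>, Markov's inequality for the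
      remainder gives \<open>2 / e\<close>. Scaled as in \<open>a\<close>, the U-statistic has mean
      square at most \<open>n\<^sup>2 * K / n ^ 3 = K / n\<close>.\<close>
    define a where "a p = (sqrt n * ((1 / (real n)\<^sup>2) * norm (\<Sum>j<n. \<Sum>i<n. u (fst p i) (snd p j))))\<^sup>2" for p
    define b where "b p = sqrt n * ((1 / n) * (\<Sum>j<n. norm (R n (fst p) (snd p j))))" for p
    have [measurable]: "a \<in> borel_measurable (PP \<Otimes>\<^sub>M QQ)" "b \<in> borel_measurable (PP \<Otimes>\<^sub>M QQ)"
      unfolding a_def b_def by measurable
    have a0: "a p \<ge> 0" and b0: "b p \<ge> 0" for p by (auto simp: a_def b_def sum_nonneg)
    have "?E n \<subseteq> {p \<in> ?\<Omega>. 1 \<le> ennreal (4 / e\<^sup>2) * ennreal (a p)} \<union> {p \<in> ?\<Omega>. 1 \<le> ennreal (2 / e) * ennreal (b p)}"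
    proof (intro subsetI)
      fix p assume p: "p \<in> ?E n"
      have "norm (S n (fst p) (snd p) - T1 n (snd p) - T2 n (fst p))
        \<le> (1 / (real n)\<^sup>2) * norm (\<Sum>j<n. \<Sum>i<n. u (fst p i) (snd p j)) + (1 / n) * (\<Sum>j<n. norm (R n (fst p) (snd p j)))"
        unfolding expansion[OF n]
        by (rule order.trans[OF norm_triangle_ineq]) (auto intro!: divide_right_mono norm_sum)
      then have "sqrt n * norm (S n (fst p) (snd p) - T1 n (snd p) - T2 n (fst p))
        \<le> sqrt n * ((1 / (real n)\<^sup>2) * norm (\<Sum>j<n. \<Sum>i<n. u (fst p i) (snd p j)) + (1 / n) * (\<Sum>j<n. norm (R n (fst p) (snd p j))))"
        by (rule mult_left_mono) simp
      also have "\<dots> = sqrt (a p) + b p" unfolding a_def b_def real_sqrt_abs by (simp add: distrib_left)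
      finally have "sqrt n * norm (S n (fst p) (snd p) - T1 n (snd p) - T2 n (fst p)) \<le> sqrt (a p) + b p" .
      with p have "e / 2 \<le> sqrt (a p) \<or> e / 2 \<le> b p" by auto
      then have "1 \<le> 4 / e\<^sup>2 * a p \<or> 1 \<le> 2 / e * b p"
      proof
        assume "e / 2 \<le> sqrt (a p)"
        then have "(e / 2)\<^sup>2 \<le> (sqrt (a p))\<^sup>2" using e by (intro power_mono) auto
        then show ?thesis using e a0[of p] by (simp add: power_divide field_simps)
      qed (use e in \<open>simp add: field_simps\<close>)
      then show "p \<in> {p \<in> ?\<Omega>. 1 \<le> ennreal (4 / e\<^sup>2) * ennreal (a p)} \<union> {p \<in> ?\<Omega>. 1 \<le> ennreal (2 / e) * ennreal (b p)}"
        using p e a0[of p] b0[of p] by (auto simp: ennreal_mult[symmetric] simp del: ennreal_1 simp: ennreal_1[symmetric])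
    qed
    then have "emeasure (PP \<Otimes>\<^sub>M QQ) (?E n) \<le> emeasure (PP \<Otimes>\<^sub>M QQ) ({p \<in> ?\<Omega>. 1 \<le> ennreal (4 / e\<^sup>2) * ennreal (a p)} \<union> {p \<in> ?\<Omega>. 1 \<le> ennreal (2 / e) * ennreal (b p)})"
      by (rule emeasure_mono) measurable
    also have "\<dots> \<le> emeasure (PP \<Otimes>\<^sub>M QQ) {p \<in> ?\<Omega>. 1 \<le> ennreal (4 / e\<^sup>2) * ennreal (a p)} + emeasure (PP \<Otimes>\<^sub>M QQ) {p \<in> ?\<Omega>. 1 \<le> ennreal (2 / e) * ennreal (b p)}"
      by (rule emeasure_subadditive) measurable
    also have "\<dots> \<le> ennreal (4 / e\<^sup>2) * (\<integral>\<^sup>+p. ennreal (a p) \<partial>(PP \<Otimes>\<^sub>M QQ)) + ennreal (2 / e) * (\<integral>\<^sup>+p. ennreal (b p) \<partial>(PP \<Otimes>\<^sub>M QQ))"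
      by (intro add_mono order.trans[OF nn_integral_Markov_inequality]) (auto intro!: mult_left_mono nn_integral_mono simp: indicator_def)
    also have "(\<integral>\<^sup>+p. ennreal (a p) \<partial>(PP \<Otimes>\<^sub>M QQ)) \<le> ennreal (K / n)"
    proof -
      have "a (xs, ys) = (1 / real n ^ 3) * (norm (\<Sum>j<n. \<Sum>i<n. u (xs i) (ys j)))\<^sup>2" for xs ys
        using n by (simp add: a_def power_mult_distrib power_divide) (simp add: eval_nat_numeral)
      then have "(\<integral>\<^sup>+p. ennreal (a p) \<partial>(PP \<Otimes>\<^sub>M QQ))
        = (\<integral>\<^sup>+xs. (\<integral>\<^sup>+ys. ennreal (1 / real n ^ 3) * ennreal ((norm (\<Sum>j<n. \<Sum>i<n. u (xs i) (ys j)))\<^sup>2) \<partial>QQ) \<partial>PP)"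
        by (subst QQ.nn_integral_fst[symmetric]) (auto simp: ennreal_mult[symmetric])
      also have "\<dots> = ennreal (1 / real n ^ 3) * (\<integral>\<^sup>+xs. (\<integral>\<^sup>+ys. ennreal ((norm (\<Sum>j<n. \<Sum>i<n. u (xs i) (ys j)))\<^sup>2) \<partial>QQ) \<partial>PP)"
      proof (subst nn_integral_cmult[symmetric], measurable, intro nn_integral_cong nn_integral_cmult)
        fix xs assume "xs \<in> space PP"
        then have [measurable]: "xs i \<in> space P" for i by (auto simp: space_PiM)
        show "(\<lambda>ys. ennreal ((norm (\<Sum>j<n. \<Sum>i<n. u (xs i) (ys j)))\<^sup>2)) \<in> borel_measurable QQ" by measurable
      qed
      also have "\<dots> \<le> ennreal (1 / real n ^ 3) * (of_nat n * (of_nat n * ennreal K))"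
        using nn_integral_U_le[of n] unfolding K by (rule mult_left_mono) simp
      also have "\<dots> = ennreal (K / n)"
        using n K0 by (simp add: ennreal_of_nat_eq_real_of_nat ennreal_mult[symmetric] power3_eq_cube)
      finally show ?thesis .
    qed
    also have "(\<integral>\<^sup>+p. ennreal (b p) \<partial>(PP \<Otimes>\<^sub>M QQ)) \<le> ennreal (R_energy n)"
      using nn_integral_R_sum_le[OF n] by (subst QQ.nn_integral_fst[symmetric]) (auto simp: b_def)
    finally have "emeasure (PP \<Otimes>\<^sub>M QQ) (?E n) \<le> ennreal (4 / e\<^sup>2) * ennreal (K / n) + ennreal (2 / e) * ennreal (R_energy n)"
      by (simp add: mult_left_mono add_mono)
    also have "\<dots> = ennreal (4 / e\<^sup>2 * (K / n) + 2 / e * R_energy n)"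
      using e K0 R0[of n] by (simp add: ennreal_mult[symmetric] ennreal_plus[symmetric] del: ennreal_plus)
    finally show ?thesis
      using e K0 R0[of n] unfolding PPQQ.P.emeasure_eq_measure by (subst (asm) ennreal_le_iff) auto
  qed
  have "(\<lambda>n. 4 / e\<^sup>2 * (K / n) + 2 / e * R_energy n) \<longlonglongrightarrow> 4 / e\<^sup>2 * 0 + 2 / e * 0"
    by (intro tendsto_add tendsto_mult_left R_energy_tendsto lim_const_over_n)
  then have lim: "(\<lambda>n. 4 / e\<^sup>2 * (K / n) + 2 / e * R_energy n) \<longlonglongrightarrow> 0" by simp
  show ?thesis
  proof (rule tendsto_sandwich[OF _ _ tendsto_const lim])
    show "\<forall>\<^sub>F n in sequentially. measure (PP \<Otimes>\<^sub>M QQ) (?E n) \<le> 4 / e\<^sup>2 * (K / n) + 2 / e * R_energy n"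
      using bound by (auto intro!: eventually_sequentiallyI[of 1])
  qed auto
qed

end

section \<open>The generalized normal density\<close>

lemma integrable_exp_neg_abs:
  assumes b: "(b::real) > 0"
  shows "integrable lborel (\<lambda>y. exp (- b * \<bar>y\<bar>))"
proof -
  have "(\<integral>\<^sup>+y. ennreal (exponential_density b y) \<partial>lborel) = 1"
    using prob_space.emeasure_space_1[OF prob_space_exponential_density[OF b]] by (simp add: emeasure_density)
  then have "integrable lborel (exponential_density b)"
    using b by (intro integrableI_nonneg) (auto intro!: AE_I2 erlang_density_nonneg)
  then have "integrable lborel (\<lambda>y. (1 / b) * exponential_density b y)" by simp
  then have "integrable lborel (\<lambda>y. indicator {0..} y *\<^sub>R exp (- b * \<bar>y\<bar>))"
    by (rule Bochner_Integration.integrable_cong[THEN iffD1, rotated -1])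
       (use b in \<open>auto simp: exponential_density_def indicator_def mult.commute\<close>)
  then show ?thesis
    by (auto dest!: has_bochner_integral_integrable intro!: has_bochner_integral_even_function[THEN has_bochner_integral_iff[THEN iffD1, THEN conjunct1]])
qed

text \<open>Trades the polynomial factor of f' for an exponential of any prescribed rate
  \<open>e\<close>, starting from
  \<open>(e * x / n) ^ n \<le> (1 + e * x / n) ^ n \<le> exp (e * x)\<close>.\<close>

lemma power_le_exp:
  assumes "0 \<le> (x::real)" "e > 0"
  shows "x ^ n \<le> (real n / e) ^ n * exp (e * x)"
proof (cases "n = 0")
  case False
  then have "(e * x / n) ^ n \<le> (1 + e * x / n) ^ n" using assms by (intro power_mono) auto
  also have "\<dots> \<le> exp (e * x)" using False assms by (intro exp_ge_one_plus_x_over_n_power_n) (auto intro: order.trans[of _ 0])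
  finally have "(real n / e) ^ n * (e * x / n) ^ n \<le> (real n / e) ^ n * exp (e * x)"
    using assms by (intro mult_left_mono) auto
  also have "(real n / e) ^ n * (e * x / n) ^ n = x ^ n"
    using False assms by (simp add: power_mult_distrib[symmetric])
  finally show ?thesis .
qed (use assms in auto)

lemma c_alpha_pos: "\<alpha> \<ge> 1 \<Longrightarrow> d > 0 \<Longrightarrow> 0 < c_alpha \<alpha> d"
  by (auto simp: c_alpha_def intro!: divide_pos_pos mult_pos_pos Gamma_real_pos)

lemma dens_pos: "\<alpha> \<ge> 1 \<Longrightarrow> d > 0 \<Longrightarrow> 0 < dens \<alpha> d t"
  by (simp add: dens_def c_alpha_pos)

lemma dens_measurable [measurable]: "dens \<alpha> d \<in> borel_measurable borel"
  unfolding dens_def[abs_def] by measurable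

lemma dens_antimono:
  assumes "\<alpha> \<ge> 1" "d > 0" "\<bar>s\<bar> \<le> \<bar>t\<bar>" shows "dens \<alpha> d t \<le> dens \<alpha> d s"
  using c_alpha_pos[OF assms(1,2)] assms(3)
  by (auto simp: dens_def intro!: mult_left_mono power_mono)

text \<open>With \<open>s = \<bar>t\<bar> / d\<close> the exponent is
  \<open>s ^ \<alpha> \<ge> s - 1\<close> for every \<open>\<alpha> \<ge> 1\<close>; the 1 accounts
  for the factor \<open>exp 1\<close>.\<close>

lemma dens_le_exp:
  assumes "\<alpha> \<ge> 1" "d > 0"
  shows "dens \<alpha> d t \<le> c_alpha \<alpha> d * exp 1 * exp (- (\<bar>t\<bar> / d))"
proof -
  define s where "s = \<bar>t\<bar> / d"
  have s: "s \<ge> 0" using assms by (simp add: s_def)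
  have "d powr (- real \<alpha>) * \<bar>t\<bar> ^ \<alpha> = s ^ \<alpha>"
    using assms by (simp add: s_def powr_minus powr_realpow divide_inverse power_mult_distrib power_inverse mult.commute)
  moreover have "s - 1 \<le> s ^ \<alpha>"
  proof (cases "s \<ge> 1")
    case True
    then show ?thesis using self_le_power[of s \<alpha>] assms by linarith
  next
    case False
    then show ?thesis using zero_le_power[OF s, of \<alpha>] by linarith
  qed
  ultimately have "exp (- (d powr (- real \<alpha>)) * \<bar>t\<bar> ^ \<alpha>) \<le> exp (1 - s)" by simp
  also have "\<dots> = exp 1 * exp (- s)" by (simp add: exp_add[symmetric])
  finally show ?thesis
    using c_alpha_pos[OF assms] unfolding dens_def s_def by (simp add: mult.assoc)
qed

lemma ddens_eq:
  assumes "t \<noteq> 0"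
  shows "ddens \<alpha> d t = - (d powr (- real \<alpha>) * real \<alpha> * \<bar>t\<bar> ^ (\<alpha> - 1) * sgn t) * dens \<alpha> d t"
proof -
  have ab: "((\<lambda>x. \<bar>x\<bar>) has_real_derivative sgn t) (at t)"
  proof (cases "t > 0")
    case True
    have "((\<lambda>x. x) has_real_derivative sgn t) (at t)" using True by simp
    then show ?thesis
      by (rule has_field_derivative_transform_within_open[where S="{0<..}"]) (use True in auto)
  next
    case False
    have "((\<lambda>x. - x) has_real_derivative sgn t) (at t)" using False assms by (auto intro!: derivative_eq_intros)
    then show ?thesis
      by (rule has_field_derivative_transform_within_open[where S="{..<0}"]) (use False assms in auto)
  qed
  have "(dens \<alpha> d has_real_derivative - (d powr (- real \<alpha>) * real \<alpha> * \<bar>t\<bar> ^ (\<alpha> - 1) * sgn t) * dens \<alpha> d t) (at t)"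
    unfolding dens_def[abs_def]
    by (rule derivative_eq_intros ab refl | simp)+
  then show ?thesis unfolding ddens_def by (rule DERIV_imp_deriv)
qed

lemma ddens_measurable [measurable]: "ddens \<alpha> d \<in> borel_measurable borel"
proof -
  have "ddens \<alpha> d = (\<lambda>t. if t = 0 then ddens \<alpha> d 0 else - (d powr (- real \<alpha>) * real \<alpha> * \<bar>t\<bar> ^ (\<alpha> - 1) * sgn t) * dens \<alpha> d t)"
    using ddens_eq by fastforce
  also have "\<dots> \<in> borel_measurable borel" by measurable
  finally show ?thesis .
qed

text \<open>The polynomial factor of f' / f is absorbed by \<open>power_le_exp\<close>. The second
  summand of \<open>C\<close> covers the origin, where for \<open>\<alpha> = 1\<close> the value of
  \<open>deriv\<close> is unspecified.\<close>

lemma ddens_bound: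
  assumes "\<alpha> \<ge> 1" "d > 0" "e > 0"
  obtains C where "C \<ge> 0" "\<And>t. \<bar>ddens \<alpha> d t\<bar> \<le> C * exp (e * \<bar>t\<bar>) * dens \<alpha> d t"
proof -
  let ?a = "d powr (- real \<alpha>) * real \<alpha>"
  let ?c = "(real (\<alpha> - 1) / e) ^ (\<alpha> - 1)"
  define C where "C = ?a * ?c + \<bar>ddens \<alpha> d 0\<bar> / dens \<alpha> d 0"
  note pos = dens_pos[OF assms(1,2)]
  have nn: "?a * ?c \<ge> 0" "\<bar>ddens \<alpha> d 0\<bar> / dens \<alpha> d 0 \<ge> 0" using assms pos[of 0] by (auto simp: less_imp_le)
  show ?thesis
  proof (rule that[of C])
    show "C \<ge> 0" using nn by (simp add: C_def)
    fix t show "\<bar>ddens \<alpha> d t\<bar> \<le> C * exp (e * \<bar>t\<bar>) * dens \<alpha> d t"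
    proof (cases "t = 0")
      case True
      have "\<bar>ddens \<alpha> d 0\<bar> = \<bar>ddens \<alpha> d 0\<bar> / dens \<alpha> d 0 * dens \<alpha> d 0" using pos[of 0] by simp
      also have "\<dots> \<le> C * dens \<alpha> d 0" using nn pos[of 0] unfolding C_def by (intro mult_right_mono) auto
      finally show ?thesis using True by simp
    next
      case False
      have "\<bar>ddens \<alpha> d t\<bar> = ?a * \<bar>t\<bar> ^ (\<alpha> - 1) * dens \<alpha> d t"
        using False pos[of t] by (simp add: ddens_eq abs_mult sgn_real_def)
      also have "\<dots> \<le> ?a * (?c * exp (e * \<bar>t\<bar>)) * dens \<alpha> d t"
        using pos[of t] assms power_le_exp[of "\<bar>t\<bar>" e "\<alpha> - 1"] by (intro mult_right_mono mult_left_mono) auto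
      also have "\<dots> = (?a * ?c) * (exp (e * \<bar>t\<bar>) * dens \<alpha> d t)" by simp
      also have "\<dots> \<le> C * (exp (e * \<bar>t\<bar>) * dens \<alpha> d t)"
        using nn pos[of t] unfolding C_def by (intro mult_right_mono) auto
      finally show ?thesis by (simp add: mult.assoc)
    qed
  qed
qed

lemma integrable_ddens:
  assumes "\<alpha> \<ge> 1" "d > 0"
  shows "integrable lborel (\<lambda>y. ddens \<alpha> d (y - s))"
proof -
  define e where "e = 1 / (2 * d)"
  have e: "e > 0" using assms by (simp add: e_def)
  obtain C where C: "C \<ge> 0" "\<And>t. \<bar>ddens \<alpha> d t\<bar> \<le> C * exp (e * \<bar>t\<bar>) * dens \<alpha> d t"
    using ddens_bound[OF assms e] by blast
  let ?c = "c_alpha \<alpha> d * exp 1"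
  have "\<bar>ddens \<alpha> d t\<bar> \<le> (C * ?c) * exp (- e * \<bar>t\<bar>)" for t
  proof -
    have "\<bar>ddens \<alpha> d t\<bar> \<le> C * exp (e * \<bar>t\<bar>) * (?c * exp (- (\<bar>t\<bar> / d)))"
      using C dens_le_exp[OF assms, of t] by (intro order.trans[OF C(2)] mult_left_mono) auto
    also have "\<dots> = (C * ?c) * (exp (e * \<bar>t\<bar>) * exp (- (\<bar>t\<bar> / d)))" by simp
    also have "exp (e * \<bar>t\<bar>) * exp (- (\<bar>t\<bar> / d)) = exp (- e * \<bar>t\<bar>)"
      using assms by (simp add: exp_add[symmetric] e_def field_simps)
    finally show ?thesis .
  qed
  then have "integrable lborel (ddens \<alpha> d)"
    by (intro Bochner_Integration.integrable_bound[OF integrable_mult_right[OF integrable_exp_neg_abs[OF e], of "C * ?c"]])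
       (auto intro: order.trans[OF _ abs_ge_self])
  from lborel_integrable_real_affine[OF this, of 1 "- s"] show ?thesis by simp
qed

text \<open>f is even, so f' is odd off the origin, and reflection turns the integral into its own
  negative. The argument covers the cusp at \<open>\<alpha> = 1\<close>, the origin being a null
  set.\<close>

lemma integral_ddens: "(\<integral>y. ddens \<alpha> d (y - s) \<partial>lborel) = 0"
proof -
  have odd: "ddens \<alpha> d (- t) = - ddens \<alpha> d t" if "t \<noteq> 0" for t
    using that by (simp add: ddens_eq sgn_minus) (simp add: dens_def)
  have "(\<integral>y. ddens \<alpha> d y \<partial>lborel) = (\<integral>y. ddens \<alpha> d (- y) \<partial>lborel)"
    by (subst lborel_integral_real_affine[where c="-1" and t=0]) auto
  also have "\<dots> = (\<integral>y. - ddens \<alpha> d y \<partial>lborel)"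
    by (rule integral_cong_AE) (use AE_lborel_singleton[of 0] odd in auto)
  finally have "(\<integral>y. ddens \<alpha> d y \<partial>lborel) = 0" by simp
  then show ?thesis
    by (subst (asm) lborel_integral_real_affine[where c=1 and t="-s"]) auto
qed

lemma densY_measurable [measurable]:
  assumes [measurable]: "fX \<in> borel_measurable borel"
  shows "densY \<alpha> d \<beta> fX \<in> borel_measurable borel"
  unfolding densY_def[abs_def] by measurable

lemma Avec_measurable [measurable]:
  assumes [measurable]: "fX \<in> borel_measurable borel"
  shows "Avec \<alpha> d \<beta> fX \<in> borel_measurable borel"
  unfolding Avec_def[abs_def] by measurable

lemma psi_measurable [measurable]:
  assumes [measurable]: "fX \<in> borel_measurable borel"
  shows "psi \<alpha> d \<beta> fX \<in> borel_measurable borel"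
  unfolding psi_def[abs_def] by measurable

section \<open>Gaussian vectors with an integrated outer product as covariance\<close>

text \<open>The norm of nested vectors is the Frobenius norm; hence square integrability of
  \<open>v\<close> makes its outer product integrable.\<close>

lemma norm_outer: "norm (outer a b) = norm a * norm b"
proof -
  have "outer a b $ i = (a $ i) *\<^sub>R b" for i by (simp add: outer_def vec_eq_iff)
  then have "norm (outer a b) = L2_set (\<lambda>i. norm (a $ i) * norm b) UNIV" by (simp add: norm_vec_def[of "outer a b"])
  also have "\<dots> = norm a * norm b" by (simp add: norm_vec_def[of a] L2_set_left_distrib)
  finally show ?thesis .
qed

lemma outer_measurable [measurable (raw)]:
  assumes [measurable]: "v \<in> borel_measurable N"
  shows "(\<lambda>x. outer (v x) (v x)) \<in> borel_measurable N"
proof -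
  have "continuous_on UNIV (\<lambda>v. outer v v)"
    unfolding outer_def by (intro continuous_intros)
  from borel_measurable_continuous_onI[OF this] show ?thesis by measurable
qed

text \<open>Pairing a matrix with \<open>s\<close> and \<open>t\<close> is bounded linear, so it
  passes under the integral. The right-hand side shows that the form is symmetric and nonnegative,
  as \<open>gaussian_exists\<close> asks.\<close>

lemma inner_integral_outer:
  fixes v :: "'x \<Rightarrow> real^'n"
  assumes [measurable]: "v \<in> borel_measurable N" and sq: "integrable N (\<lambda>x. (norm (v x))\<^sup>2)"
  shows "s \<bullet> ((\<integral>x. outer (v x) (v x) \<partial>N) *v t) = (\<integral>x. (s \<bullet> v x) * (t \<bullet> v x) \<partial>N)"
proof -
  have "linear (\<lambda>G :: real^'n^'n. s \<bullet> (G *v t))"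
    by (rule linearI) (simp_all add: matrix_vector_mult_add_rdistrib inner_add_right scaleR_matrix_vector_assoc[symmetric])
  then have bl: "bounded_linear (\<lambda>G :: real^'n^'n. s \<bullet> (G *v t))" by (simp add: linear_conv_bounded_linear)
  have int: "integrable N (\<lambda>x. outer (v x) (v x))"
    by (rule Bochner_Integration.integrable_bound[OF sq]) (auto simp: norm_outer power2_eq_square)
  have "s \<bullet> ((\<integral>x. outer (v x) (v x) \<partial>N) *v t) = (\<integral>x. s \<bullet> (outer (v x) (v x) *v t) \<partial>N)"
    by (rule integral_bounded_linear[OF bl int, symmetric])
  also have "\<dots> = (\<integral>x. (s \<bullet> v x) * (t \<bullet> v x) \<partial>N)"
  proof -
    have "outer a a *v t = (t \<bullet> a) *\<^sub>R a" for a
      by (simp add: vec_eq_iff outer_def matrix_vector_mult_def inner_vec_def sum_distrib_left sum_distrib_right mult_ac)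
    then show ?thesis by (simp add: mult.commute)
  qed
  finally show ?thesis .
qed

lemma centered_gaussian_exists:
  fixes v :: "'x \<Rightarrow> real^'n"
  assumes "v \<in> borel_measurable N" "integrable N (\<lambda>x. (norm (v x))\<^sup>2)"
  shows "\<exists>\<mu>. centered_gaussian \<mu> (\<integral>x. outer (v x) (v x) \<partial>N)"
proof -
  let ?G = "\<integral>x. outer (v x) (v x) \<partial>N"
  note eq = inner_integral_outer[OF assms]
  obtain \<mu> where "prob_space \<mu>" "sets \<mu> = sets borel"
    "\<And>t. (\<integral>x. cis (t \<bullet> x) \<partial>\<mu>) = complex_of_real (exp (- (t \<bullet> (?G *v t)) / 2))"
  proof (rule gaussian_exists[of "\<lambda>s t. s \<bullet> (?G *v t)"])
    show "linear (\<lambda>t. s \<bullet> (?G *v t))" for s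
      by (rule linearI) (simp_all add: matrix_vector_right_distrib inner_add_right matrix_vector_mult_scaleR)
    show "s \<bullet> (?G *v t) = t \<bullet> (?G *v s)" for s t by (simp add: eq mult.commute)
    show "t \<bullet> (?G *v t) \<ge> 0" for t by (simp add: eq)
  qed (rule that)
  then show ?thesis by (auto simp: centered_gaussian_def)
qed

section \<open>The expansion and the limit laws for the regression model\<close>

theorem theorem4:
  fixes M :: "'w measure"
    and Xt :: "nat \<Rightarrow> 'w \<Rightarrow> real^'p"
    and Yt :: "nat \<Rightarrow> 'w \<Rightarrow> real"
    and fX :: "real^'p \<Rightarrow> real"
    and \<beta>0 :: "real^'p"
    and \<alpha> :: nat and d :: real
  assumes "prob_space M"
    and alpha: "\<alpha> \<ge> 1" and d: "d > 0"
    and fX_meas: "fX \<in> borel_measurable lborel" and fX_nonneg: "\<And>x. fX x \<ge> 0"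
    and bounded: "\<exists>B>0. measure (density lborel (\<lambda>x. ennreal (fX x))) {x. norm x \<le> B} = 1"
    and hyperplanes: "\<And>v. v \<noteq> 0 \<Longrightarrow> measure (density lborel (\<lambda>x. ennreal (fX x))) {x. v \<bullet> x = 0} = 0"
    and X_distr: "\<And>i. distributed M lborel (Xt i) (\<lambda>x. ennreal (fX x))"
    and Y_distr: "\<And>j. distributed M lborel (Yt j) (\<lambda>y. ennreal (densY \<alpha> d \<beta>0 fX y))"
    and X_indep: "prob_space.indep_vars M (\<lambda>_. borel) Xt UNIV"
    and Y_indep: "prob_space.indep_vars M (\<lambda>_. borel) Yt UNIV"
    and XY_indep: "distr M (PiM UNIV (\<lambda>_. borel) \<Otimes>\<^sub>M PiM UNIV (\<lambda>_. borel))
                       (\<lambda>\<omega>. (\<lambda>i. Xt i \<omega>, \<lambda>j. Yt j \<omega>))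
                 = distr M (PiM UNIV (\<lambda>_. borel)) (\<lambda>\<omega> i. Xt i \<omega>)
                   \<Otimes>\<^sub>M distr M (PiM UNIV (\<lambda>_. borel)) (\<lambda>\<omega> j. Yt j \<omega>)"
  shows
    "let f = dens \<alpha> d; f' = ddens \<alpha> d; fY = densY \<alpha> d \<beta>0 fX;
         A = Avec \<alpha> d \<beta>0 fX; \<psi> = psi \<alpha> d \<beta>0 fX;
         E\<psi> = (\<integral>x. fX x *\<^sub>R \<psi> x \<partial>lborel);
         S = (\<lambda>n \<omega>. (1 / real n) *\<^sub>R (\<Sum>j<n.
                 ((1 / real n) *\<^sub>R (\<Sum>i<n. f' (Yt j \<omega> - \<beta>0 \<bullet> Xt i \<omega>) *\<^sub>R Xt i \<omega>))
                 /\<^sub>R ((1 / real n) * (\<Sum>i<n. f (Yt j \<omega> - \<beta>0 \<bullet> Xt i \<omega>)))));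
         T1 = (\<lambda>n \<omega>. (1 / real n) *\<^sub>R (\<Sum>j<n. (1 / fY (Yt j \<omega>)) *\<^sub>R A (Yt j \<omega>)));
         T2 = (\<lambda>n \<omega>. (1 / real n) *\<^sub>R (\<Sum>i<n. \<psi> (Xt i \<omega>)) - E\<psi>)
     in (\<forall>e>0. (\<lambda>n. measure M {\<omega>\<in>space M.
              sqrt (real n) * norm (S n \<omega> - T1 n \<omega> - T2 n \<omega>) > e}) \<longlonglongrightarrow> 0)
      \<and> (\<exists>\<mu>1 \<mu>2. centered_gaussian \<mu>1 (Gamma1 \<alpha> d \<beta>0 fX)
             \<and> centered_gaussian \<mu>2 (Gamma2 \<alpha> d \<beta>0 fX)
             \<and> conv_in_distr (\<lambda>n. distr M borel (\<lambda>\<omega>. sqrt (real n) *\<^sub>R T1 n \<omega>)) \<mu>1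
             \<and> conv_in_distr (\<lambda>n. distr M borel (\<lambda>\<omega>. sqrt (real n) *\<^sub>R T2 n \<omega>)) \<mu>2
             \<and> conv_in_distr (\<lambda>n. distr M borel
                   (\<lambda>\<omega>. (sqrt (real n) *\<^sub>R T1 n \<omega>, sqrt (real n) *\<^sub>R T2 n \<omega>))) (\<mu>1 \<Otimes>\<^sub>M \<mu>2))"
proof -
  interpret M: prob_space M by fact
  have [measurable]: "fX \<in> borel_measurable borel" using fX_meas by simp
  obtain B where B: "B > 0" "measure (density lborel (\<lambda>x. ennreal (fX x))) {x. norm x \<le> B} = 1"
    using bounded by blast
  define P where "P = density lborel (\<lambda>x. ennreal (fX x))"
  have sets_P [measurable_cong, simp]: "sets P = sets borel" and space_P [simp]: "space P = UNIV" by (simp_all add: P_def)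
  have Xm [measurable]: "Xt i \<in> borel_measurable M" and Ym [measurable]: "Yt i \<in> borel_measurable M" for i
    using X_distr[of i] Y_distr[of i] by (simp_all add: distributed_def)
  have lawX: "distr M borel (Xt i) = P" for i
  proof -
    have "distr M borel (Xt i) = distr M lborel (Xt i)" by (rule distr_cong) simp_all
    then show ?thesis using X_distr[of i] by (simp add: distributed_def P_def)
  qed
  interpret P: prob_space P unfolding lawX[of 0, symmetric] by (rule M.prob_space_distr) simp
  have AE_P: "AE x in P. norm x \<le> B"
    using P.AE_in_set_eq_1[of "{x. norm x \<le> B}"] B(2) by (simp add: P_def)
  txt \<open>Truncating at the almost sure bound \<open>B\<close> makes the kernel bounds hold for every \<open>x\<close>.\<close>
  define \<tau> where "\<tau> x = (if norm x \<le> B then x else 0)" for x :: "real^'p"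
  have \<tau>m [measurable]: "\<tau> \<in> borel_measurable borel" unfolding \<tau>_def by measurable
  have AE_\<tau>: "AE x in P. \<tau> x = x" using AE_P by eventually_elim (simp add: \<tau>_def)
  have norm_\<tau>: "norm (\<tau> x) \<le> B" for x using B by (simp add: \<tau>_def)
  define K where "K = norm \<beta>0 * B"
  have s_le: "\<bar>\<beta>0 \<bullet> \<tau> x\<bar> \<le> K" for x
    using Cauchy_Schwarz_ineq2[of \<beta>0 "\<tau> x"] mult_left_mono[OF norm_\<tau>[of x] norm_ge_zero[of \<beta>0]] by (simp add: K_def)
  \<comment> \<open>\<open>q\<close> grows at rate \<open>e0\<close> and \<open>G\<close> decays at
    rate \<open>1 / d\<close>; this choice leaves \<open>(q y)\<^sup>2 * G y\<close> decaying at
    rate \<open>1 / (2 * d)\<close>.\<close>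
  define e0 where "e0 = 1 / (4 * d)"
  have e0: "e0 > 0" using d by (simp add: e0_def)
  obtain C where C: "C \<ge> 0" "\<And>t. \<bar>ddens \<alpha> d t\<bar> \<le> C * exp (e0 * \<bar>t\<bar>) * dens \<alpha> d t"
    using ddens_bound[OF alpha d e0] by blast
  note pos = dens_pos[OF alpha d]
  define k where "k x y = dens \<alpha> d (y - \<beta>0 \<bullet> \<tau> x)" for x y
  define H where "H x y = ddens \<alpha> d (y - \<beta>0 \<bullet> \<tau> x) *\<^sub>R \<tau> x" for x y
  \<comment> \<open>Since \<open>\<bar>\<beta>0 \<bullet> \<tau> x\<bar> \<le> K\<close>, the
    argument of the density has modulus between \<open>\<bar>y\<bar> - K\<close> and
    \<open>\<bar>y\<bar> + K\<close>; the upper end gives \<open>m\<close>, the lower end the factor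
    \<open>exp (K / d)\<close> of \<open>c0\<close>.\<close>
  define m where "m y = dens \<alpha> d (\<bar>y\<bar> + K)" for y
  define c0 where "c0 = c_alpha \<alpha> d * exp 1 * exp (K / d)"
  define G where "G y = c0 * exp (- (\<bar>y\<bar> / d))" for y
  \<comment> \<open>\<open>B\<close> bounds \<open>norm (\<tau> x)\<close>, and
    \<open>C * exp (e0 * K)\<close> is the constant of \<open>ddens_bound\<close> after shifting its
    argument by up to \<open>K\<close>; the summand 1 secures \<open>1 \<le> q y\<close>.\<close>
  define q0 where "q0 = 1 + B * C * exp (e0 * K)"
  have q0: "q0 \<ge> 1" using B C by (simp add: q0_def)
  define q where "q y = q0 * exp (e0 * \<bar>y\<bar>)" for y
  have int_P: "(\<integral>x. F x \<partial>P) = (\<integral>x. fX x *\<^sub>R F x \<partial>lborel)"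
    if "F \<in> borel_measurable borel" for F :: "real^'p \<Rightarrow> 'b::{banach, second_countable_topology}"
    unfolding P_def using that fX_nonneg by (subst integral_density) auto
  have k_densY: "(\<integral>x. k x y \<partial>P) = densY \<alpha> d \<beta>0 fX y" for y
  proof -
    have "(\<integral>x. k x y \<partial>P) = (\<integral>x. dens \<alpha> d (y - \<beta>0 \<bullet> x) \<partial>P)"
      unfolding k_def by (intro integral_cong_AE) (use AE_\<tau> in auto)
    then show ?thesis by (simp add: int_P densY_def mult.commute)
  qed
  have H_Avec: "(\<integral>x. H x y \<partial>P) = Avec \<alpha> d \<beta>0 fX y" for y
  proof -
    have "(\<integral>x. H x y \<partial>P) = (\<integral>x. ddens \<alpha> d (y - \<beta>0 \<bullet> x) *\<^sub>R x \<partial>P)"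
      unfolding H_def by (intro integral_cong_AE) (use AE_\<tau> in auto)
    then show ?thesis by (simp add: int_P Avec_def mult.commute)
  qed
  have lawY: "distr M borel (Yt j) = density lborel (\<lambda>y. ennreal (densY \<alpha> d \<beta>0 fX y))" for j
  proof -
    have "distr M borel (Yt j) = distr M lborel (Yt j)" by (rule distr_cong) simp_all
    then show ?thesis using Y_distr[of j] by (simp add: distributed_def)
  qed
  have mass: "prob_space (density lborel (\<lambda>y. ennreal (\<integral>x. k x y \<partial>P)))"
    unfolding k_densY lawY[of 0, symmetric] by (rule M.prob_space_distr) simp
  interpret K: two_sample_kernel P k H m G q
  proof (intro two_sample_kernel.intro two_sample_kernel_axioms.intro P.prob_space_axioms mass)
    show "case_prod k \<in> borel_measurable (P \<Otimes>\<^sub>M borel)" unfolding k_def by measurable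
    show "case_prod H \<in> borel_measurable (P \<Otimes>\<^sub>M borel)" unfolding H_def by measurable
    show "G \<in> borel_measurable borel" "q \<in> borel_measurable borel" "m \<in> borel_measurable borel"
      unfolding G_def[abs_def] q_def[abs_def] m_def[abs_def] by measurable
    show "0 < m y" for y unfolding m_def by (rule pos)
    show "m y \<le> k x y" for x y
      unfolding m_def k_def using s_le[of x] by (intro dens_antimono alpha d) linarith
    show "k x y \<le> G y" for x y
    proof -
      have "k x y \<le> c_alpha \<alpha> d * exp 1 * exp (- (\<bar>y - \<beta>0 \<bullet> \<tau> x\<bar> / d))"
        unfolding k_def by (rule dens_le_exp[OF alpha d])
      also have "\<dots> \<le> c_alpha \<alpha> d * exp 1 * exp (K / d - \<bar>y\<bar> / d)"
      proof -
        have "\<bar>y\<bar> - K \<le> \<bar>y - \<beta>0 \<bullet> \<tau> x\<bar>" using s_le[of x] by linarith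
        then have "(\<bar>y\<bar> - K) / d \<le> \<bar>y - \<beta>0 \<bullet> \<tau> x\<bar> / d" using d by (intro divide_right_mono) auto
        then show ?thesis using c_alpha_pos[OF alpha d] by (simp add: diff_divide_distrib)
      qed
      also have "\<dots> = G y" by (simp add: G_def c0_def exp_diff exp_minus divide_inverse)
      finally show ?thesis .
    qed
    show "1 \<le> q y" for y
    proof -
      have "1 * 1 \<le> q0 * exp (e0 * \<bar>y\<bar>)" using q0 e0 by (intro mult_mono) auto
      then show ?thesis by (simp add: q_def)
    qed
    show "norm (H x y) \<le> q y * k x y" for x y
    proof -
      have "norm (H x y) = \<bar>ddens \<alpha> d (y - \<beta>0 \<bullet> \<tau> x)\<bar> * norm (\<tau> x)" by (simp add: H_def)
      also have "\<dots> \<le> (C * exp (e0 * \<bar>y - \<beta>0 \<bullet> \<tau> x\<bar>) * k x y) * B"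
        using C norm_\<tau>[of x] pos by (intro mult_mono) (auto simp: k_def less_imp_le)
      also have "\<dots> \<le> (C * exp (e0 * K + e0 * \<bar>y\<bar>) * k x y) * B"
      proof -
        have "e0 * \<bar>y - \<beta>0 \<bullet> \<tau> x\<bar> \<le> e0 * (K + \<bar>y\<bar>)" using s_le[of x] e0 by (intro mult_left_mono) auto
        then show ?thesis using C B pos[of "y - \<beta>0 \<bullet> \<tau> x"]
          by (intro mult_right_mono mult_left_mono) (auto simp: k_def distrib_left less_imp_le)
      qed
      also have "\<dots> = (B * C * exp (e0 * K)) * exp (e0 * \<bar>y\<bar>) * k x y" by (simp add: exp_add)
      also have "\<dots> \<le> q y * k x y"
        unfolding q_def q0_def k_def using pos by (intro mult_right_mono) (auto simp: less_imp_le)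
      finally show ?thesis .
    qed
    show "integrable lborel (\<lambda>y. (q y)\<^sup>2 * G y)"
    proof -
      have "(q y)\<^sup>2 * G y = (q0\<^sup>2 * c0) * exp (- (1 / (2 * d)) * \<bar>y\<bar>)" for y
      proof -
        have "(exp (e0 * \<bar>y\<bar>))\<^sup>2 * exp (- (\<bar>y\<bar> / d)) = exp (- (1 / (2 * d)) * \<bar>y\<bar>)"
          using d by (simp add: power2_eq_square exp_add[symmetric] e0_def field_simps)
        then show ?thesis by (simp add: q_def G_def power_mult_distrib mult_ac)
      qed
      then show ?thesis using integrable_exp_neg_abs[of "1 / (2 * d)"] d by simp
    qed
    show "(\<integral>y. H x y \<partial>lborel) = 0" for x
      unfolding H_def by (simp add: integral_ddens integrable_ddens[OF alpha d])
  qed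
  have fY: "K.fY = densY \<alpha> d \<beta>0 fX" by (simp add: fun_eq_iff K.fY_def k_densY)
  have A: "K.A = Avec \<alpha> d \<beta>0 fX" by (simp add: fun_eq_iff K.A_def H_Avec)
  have r: "K.r y = (1 / densY \<alpha> d \<beta>0 fX y) *\<^sub>R Avec \<alpha> d \<beta>0 fX y" for y by (simp add: K.r_def fY A)
  have \<psi>: "K.\<psi> x = psi \<alpha> d \<beta>0 fX (\<tau> x)" for x
    by (simp add: K.\<psi>_def psi_def r k_def)
  have AE_\<psi>: "AE x in P. K.\<psi> x = psi \<alpha> d \<beta>0 fX x"
    using AE_\<tau> by eventually_elim (simp add: \<psi>)
  \<comment> \<open>Hence the centering subtracted in \<open>T2\<close> is zero and
    \<open>T2\<close> has the form of \<open>K.T2\<close>.\<close>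
  have E\<psi>: "(\<integral>x. fX x *\<^sub>R psi \<alpha> d \<beta>0 fX x \<partial>lborel) = 0"
  proof -
    have "(\<integral>x. fX x *\<^sub>R psi \<alpha> d \<beta>0 fX x \<partial>lborel) = (\<integral>x. psi \<alpha> d \<beta>0 fX x \<partial>P)" by (simp add: int_P)
    also have "\<dots> = (\<integral>x. K.\<psi> x \<partial>P)" by (intro integral_cong_AE) (use AE_\<psi> in auto)
    finally show ?thesis using K.integral_\<psi> by simp
  qed
  have lawYQ: "distr M borel (Yt j) = K.Q" for j by (simp add: lawY K.Q_def fY)
  \<comment> \<open>The outer product of \<open>K.r y\<close> carries the inverse square of
    \<open>fY\<close>; the density of \<open>K.Q\<close> reduces it to the single inverse in
    \<open>Gamma1\<close>.\<close>
  have G1: "Gamma1 \<alpha> d \<beta>0 fX = (\<integral>y. outer (K.r y) (K.r y) \<partial>K.Q)"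
  proof -
    have "outer (c *\<^sub>R a) (c *\<^sub>R a) = (c * c) *\<^sub>R outer a a" for c and a :: "real^'p"
      by (simp add: outer_def vec_eq_iff)
    moreover have "densY \<alpha> d \<beta>0 fX y \<noteq> 0" for y using K.fY_pos[of y] by (simp add: fY)
    ultimately show ?thesis unfolding Gamma1_def by (subst K.integral_Q) (simp_all add: r fY)
  qed
  have G2: "Gamma2 \<alpha> d \<beta>0 fX = (\<integral>x. outer (K.\<psi> x) (K.\<psi> x) \<partial>P)"
  proof -
    have "Bvec \<alpha> d \<beta>0 fX x = - psi \<alpha> d \<beta>0 fX x" for x by (simp add: Bvec_def psi_def)
    moreover have "outer (- a) (- a) = outer a a" for a :: "real^'p" by (simp add: outer_def)
    ultimately have "Gamma2 \<alpha> d \<beta>0 fX = (\<integral>x. outer (psi \<alpha> d \<beta>0 fX x) (psi \<alpha> d \<beta>0 fX x) \<partial>P)"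
      by (simp add: Gamma2_def int_P)
    also have "\<dots> = (\<integral>x. outer (K.\<psi> x) (K.\<psi> x) \<partial>P)" by (intro integral_cong_AE) (use AE_\<psi> in auto)
    finally show ?thesis .
  qed
  \<comment> \<open>Almost surely the truncation moves no sample point, for all indices at once, so
    the statistics agree almost surely with their versions in the locale.\<close>
  have AE_X: "AE \<omega> in M. \<forall>i. \<tau> (Xt i \<omega>) = Xt i \<omega>"
  proof (subst AE_all_countable, intro allI)
    fix i
    have "AE x in distr M borel (Xt i). \<tau> x = x" unfolding lawX by (rule AE_\<tau>)
    then show "AE \<omega> in M. \<tau> (Xt i \<omega>) = Xt i \<omega>" by (subst (asm) AE_distr_iff) auto
  qed
  have seqX: "distr M (PiM UNIV (\<lambda>_. borel)) (\<lambda>\<omega> i. Xt i \<omega>) = K.PP"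
    using M.indep_vars_iff_distr_eq_PiM[where I=UNIV and X=Xt and M'="\<lambda>_. borel"] X_indep by (simp add: lawX restrict_UNIV)
  have seqY: "distr M (PiM UNIV (\<lambda>_. borel)) (\<lambda>\<omega> j. Yt j \<omega>) = K.QQ"
    using M.indep_vars_iff_distr_eq_PiM[where I=UNIV and X=Yt and M'="\<lambda>_. borel"] Y_indep by (simp add: lawYQ restrict_UNIV)
  let ?\<Phi> = "\<lambda>\<omega>. (\<lambda>i. Xt i \<omega>, \<lambda>j. Yt j \<omega>)"
  let ?N = "PiM UNIV (\<lambda>_. borel) \<Otimes>\<^sub>M PiM UNIV (\<lambda>_. borel) :: ((nat \<Rightarrow> real^'p) \<times> (nat \<Rightarrow> real)) measure"
  \<comment> \<open>The two sequences jointly have the law of the canonical product, to which the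
    event in \<open>part1\<close> and the integral in \<open>VW\<close> are transferred.\<close>
  have law: "distr M ?N ?\<Phi> = K.PP \<Otimes>\<^sub>M K.QQ" using XY_indep by (simp only: seqX seqY)
  have \<Phi> [measurable]: "?\<Phi> \<in> measurable M ?N" by (intro measurable_Pair measurable_PiM_single') auto
  have \<psi>m [measurable]: "K.\<psi> \<in> borel_measurable borel"
    using K.\<psi>_meas measurable_cong_sets[OF sets_P refl] by blast
  define S where "S n \<omega> = (1 / real n) *\<^sub>R (\<Sum>j<n.
      ((1 / real n) *\<^sub>R (\<Sum>i<n. ddens \<alpha> d (Yt j \<omega> - \<beta>0 \<bullet> Xt i \<omega>) *\<^sub>R Xt i \<omega>))
      /\<^sub>R ((1 / real n) * (\<Sum>i<n. dens \<alpha> d (Yt j \<omega> - \<beta>0 \<bullet> Xt i \<omega>))))" for n \<omega>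
  define T1 where "T1 n \<omega> = (1 / real n) *\<^sub>R (\<Sum>j<n. (1 / densY \<alpha> d \<beta>0 fX (Yt j \<omega>)) *\<^sub>R Avec \<alpha> d \<beta>0 fX (Yt j \<omega>))" for n \<omega>
  define T2 where "T2 n \<omega> = (1 / real n) *\<^sub>R (\<Sum>i<n. psi \<alpha> d \<beta>0 fX (Xt i \<omega>)) - (\<integral>x. fX x *\<^sub>R psi \<alpha> d \<beta>0 fX x \<partial>lborel)" for n \<omega>
  have [measurable]: "S n \<in> borel_measurable M" "T1 n \<in> borel_measurable M" "T2 n \<in> borel_measurable M" for n
    unfolding S_def[abs_def] T1_def[abs_def] T2_def[abs_def] by measurable
  have T1_K: "T1 n \<omega> = K.T1 n (\<lambda>j. Yt j \<omega>)" for n \<omega> by (simp add: T1_def K.T1_def r)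
  have AE_ST: "AE \<omega> in M. S n \<omega> = K.S n (\<lambda>i. Xt i \<omega>) (\<lambda>j. Yt j \<omega>) \<and> T2 n \<omega> = K.T2 n (\<lambda>i. Xt i \<omega>)" for n
    using AE_X by eventually_elim
      (simp add: S_def T2_def E\<psi> K.S_def K.rn_def K.D_def H_def k_def K.T2_def \<psi>)
  have part1: "(\<lambda>n. measure M {\<omega>\<in>space M. sqrt (real n) * norm (S n \<omega> - T1 n \<omega> - T2 n \<omega>) > e}) \<longlonglongrightarrow> 0"
    if e: "e > 0" for e
  proof -
    let ?E = "\<lambda>n. {p \<in> space (K.PP \<Otimes>\<^sub>M K.QQ). sqrt (real n) * norm (K.S n (fst p) (snd p) - K.T1 n (snd p) - K.T2 n (fst p)) > e}"
    have "measure M {\<omega>\<in>space M. sqrt (real n) * norm (S n \<omega> - T1 n \<omega> - T2 n \<omega>) > e} = measure (K.PP \<Otimes>\<^sub>M K.QQ) (?E n)" for n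
    proof -
      have E: "?E n \<in> sets (K.PP \<Otimes>\<^sub>M K.QQ)"
        unfolding K.S_def K.T1_def K.T2_def by measurable
      then have E': "?E n \<in> sets ?N" unfolding law[symmetric] by simp
      have "measure (K.PP \<Otimes>\<^sub>M K.QQ) (?E n) = measure M (?\<Phi> -` ?E n \<inter> space M)"
        unfolding law[symmetric] using E' by (subst measure_distr[OF \<Phi>]) (simp_all add: law)
      also have "\<dots> = measure M {\<omega>\<in>space M. sqrt (real n) * norm (S n \<omega> - T1 n \<omega> - T2 n \<omega>) > e}"
      proof (rule M.finite_measure_eq_AE)
        show "?\<Phi> -` ?E n \<inter> space M \<in> sets M" using measurable_sets[OF \<Phi> E'] .
        show "AE \<omega> in M. (\<omega> \<in> ?\<Phi> -` ?E n \<inter> space M) = (\<omega> \<in> {\<omega>\<in>space M. sqrt (real n) * norm (S n \<omega> - T1 n \<omega> - T2 n \<omega>) > e})"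
          using AE_ST[of n] AE_space
        proof eventually_elim
          case (elim \<omega>)
          then show ?case using measurable_space[OF \<Phi>, of \<omega>] by (simp add: T1_K space_pair_measure space_PiM)
        qed
      qed measurable
      finally show ?thesis by simp
    qed
    then show ?thesis using K.expansion_in_probability[OF e] by simp
  qed
  define V where "V j \<omega> = K.r (Yt j \<omega>)" for j \<omega>
  define W where "W i \<omega> = K.\<psi> (Xt i \<omega>)" for i \<omega>
  have V: "M.indep_vars (\<lambda>_. borel) V UNIV" "distr M borel (V j) = distr K.Q borel K.r"
    "M.expectation (V j) = 0" "integrable M (\<lambda>\<omega>. (norm (V j \<omega>))\<^sup>2)" for j
  proof -
    show "M.indep_vars (\<lambda>_. borel) V UNIV" unfolding V_def[abs_def] by (rule M.indep_vars_compose2[OF Y_indep]) simp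
    show "distr M borel (V j) = distr K.Q borel K.r"
      unfolding lawYQ[of j, symmetric] by (subst distr_distr) (auto simp: V_def[abs_def] comp_def)
    have "M.expectation (V j) = (\<integral>y. K.r y \<partial>distr M borel (Yt j))" by (simp add: integral_distr V_def[abs_def])
    then show "M.expectation (V j) = 0" by (simp add: lawYQ K.integral_r)
    have "integrable (distr M borel (Yt j)) (\<lambda>y. (norm (K.r y))\<^sup>2)" unfolding lawYQ by (rule K.r_square_int)
    then show "integrable M (\<lambda>\<omega>. (norm (V j \<omega>))\<^sup>2)" by (simp add: integrable_distr_eq V_def)
  qed
  have \<psi>_sq: "integrable P (\<lambda>x. (norm (K.\<psi> x))\<^sup>2)"
    by (rule P.integrable_const_bound[where B="(\<integral>y. q y * G y \<partial>lborel)\<^sup>2"]) (auto intro!: AE_I2 power_mono K.norm_\<psi>_le)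
  have W: "M.indep_vars (\<lambda>_. borel) W UNIV" "distr M borel (W i) = distr P borel K.\<psi>"
    "M.expectation (W i) = 0" "integrable M (\<lambda>\<omega>. (norm (W i \<omega>))\<^sup>2)" for i
  proof -
    show "M.indep_vars (\<lambda>_. borel) W UNIV" unfolding W_def[abs_def] by (rule M.indep_vars_compose2[OF X_indep]) simp
    have "distr M borel (W i) = distr (distr M borel (Xt i)) borel K.\<psi>"
      by (subst distr_distr) (auto simp: W_def[abs_def] comp_def)
    then show "distr M borel (W i) = distr P borel K.\<psi>" by (simp only: lawX)
    have "M.expectation (W i) = (\<integral>x. K.\<psi> x \<partial>distr M borel (Xt i))" by (simp add: integral_distr W_def[abs_def])
    then show "M.expectation (W i) = 0" by (simp add: lawX K.integral_\<psi>)
    have "integrable (distr M borel (Xt i)) (\<lambda>x. (norm (K.\<psi> x))\<^sup>2)" unfolding lawX by (rule \<psi>_sq)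
    then show "integrable M (\<lambda>\<omega>. (norm (W i \<omega>))\<^sup>2)" by (simp add: integrable_distr_eq W_def)
  qed
  \<comment> \<open>Both factors have modulus 1, so Fubini applies under the product law of the two
    sequences.\<close>
  have VW: "M.expectation (\<lambda>\<omega>. cis (a \<bullet> (\<Sum>i<n. V i \<omega>)) * cis (b \<bullet> (\<Sum>i<n. W i \<omega>)))
      = M.expectation (\<lambda>\<omega>. cis (a \<bullet> (\<Sum>i<n. V i \<omega>))) * M.expectation (\<lambda>\<omega>. cis (b \<bullet> (\<Sum>i<n. W i \<omega>)))" for n a b
  proof -
    define g where "g ys = cis (a \<bullet> (\<Sum>i<n. K.r (ys i)))" for ys :: "nat \<Rightarrow> real"
    define f where "f xs = cis (b \<bullet> (\<Sum>i<n. K.\<psi> (xs i)))" for xs :: "nat \<Rightarrow> real^'p"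
    have [measurable]: "g \<in> borel_measurable (PiM UNIV (\<lambda>_. borel))" "f \<in> borel_measurable (PiM UNIV (\<lambda>_. borel))"
      unfolding g_def[abs_def] f_def[abs_def] by measurable
    have seq_meas [measurable]: "(\<lambda>\<omega> i. Xt i \<omega>) \<in> measurable M (PiM UNIV (\<lambda>_. borel))" "(\<lambda>\<omega> j. Yt j \<omega>) \<in> measurable M (PiM UNIV (\<lambda>_. borel))"
      by (intro measurable_PiM_single'; auto)+
    have int: "integrable (K.PP \<Otimes>\<^sub>M K.QQ) (\<lambda>(xs, ys). f xs * g ys)"
      by (rule K.PPQQ.P.integrable_const_bound[where B=1]) (auto simp: f_def g_def norm_mult, measurable)
    have "M.expectation (\<lambda>\<omega>. g (\<lambda>j. Yt j \<omega>) * f (\<lambda>i. Xt i \<omega>)) = (\<integral>p. (case p of (xs, ys) \<Rightarrow> f xs * g ys) \<partial>distr M ?N ?\<Phi>)"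
      by (subst integral_distr) (auto simp: mult.commute)
    also have "\<dots> = (\<integral>xs. (\<integral>ys. f xs * g ys \<partial>K.QQ) \<partial>K.PP)"
      unfolding law using K.PPQQ.integral_fst'[OF int] by simp
    also have "\<dots> = (\<integral>ys. g ys \<partial>K.QQ) * (\<integral>xs. f xs \<partial>K.PP)" by (simp add: mult.commute)
    also have "(\<integral>ys. g ys \<partial>K.QQ) = M.expectation (\<lambda>\<omega>. g (\<lambda>j. Yt j \<omega>))"
      unfolding seqY[symmetric] by (rule integral_distr) measurable
    also have "(\<integral>xs. f xs \<partial>K.PP) = M.expectation (\<lambda>\<omega>. f (\<lambda>i. Xt i \<omega>))"
      unfolding seqX[symmetric] by (rule integral_distr) measurable
    finally show ?thesis by (simp add: f_def g_def V_def W_def)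
  qed
  obtain \<mu>1 where \<mu>1: "centered_gaussian \<mu>1 (Gamma1 \<alpha> d \<beta>0 fX)"
    unfolding G1 using centered_gaussian_exists[OF _ K.r_square_int] by auto
  obtain \<mu>2 where \<mu>2: "centered_gaussian \<mu>2 (Gamma2 \<alpha> d \<beta>0 fX)"
    unfolding G2 using centered_gaussian_exists[OF _ \<psi>_sq] by auto
  have var1: "t \<bullet> (Gamma1 \<alpha> d \<beta>0 fX *v t) = M.expectation (\<lambda>\<omega>. (t \<bullet> V 0 \<omega>)\<^sup>2)" for t
  proof -
    have "t \<bullet> (Gamma1 \<alpha> d \<beta>0 fX *v t) = (\<integral>y. (t \<bullet> K.r y)\<^sup>2 \<partial>distr M borel (Yt 0))"
      unfolding G1 lawYQ using inner_integral_outer[OF _ K.r_square_int] by (simp add: power2_eq_square)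
    then show ?thesis by (simp add: integral_distr V_def)
  qed
  have var2: "t \<bullet> (Gamma2 \<alpha> d \<beta>0 fX *v t) = M.expectation (\<lambda>\<omega>. (t \<bullet> W 0 \<omega>)\<^sup>2)" for t
  proof -
    have "t \<bullet> (Gamma2 \<alpha> d \<beta>0 fX *v t) = (\<integral>x. (t \<bullet> K.\<psi> x)\<^sup>2 \<partial>distr M borel (Xt 0))"
      unfolding G2 lawX using inner_integral_outer[OF _ \<psi>_sq] by (simp add: power2_eq_square)
    then show ?thesis by (simp add: integral_distr W_def)
  qed
  note \<mu>1' = \<mu>1[unfolded centered_gaussian_def var1] and \<mu>2' = \<mu>2[unfolded centered_gaussian_def var2]
  have clt: "conv_in_distr (\<lambda>n. distr M borel (\<lambda>\<omega>. ((1 / sqrt (real n)) *\<^sub>R (\<Sum>i<n. V i \<omega>), (1 / sqrt (real n)) *\<^sub>R (\<Sum>i<n. W i \<omega>)))) (\<mu>1 \<Otimes>\<^sub>M \<mu>2)"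
    by (rule M.joint_central_limit[OF V W VW]) (use \<mu>1' \<mu>2' in blast)+
  \<comment> \<open>At \<open>n = 0\<close> both sides are 0 by the convention for division, so the
    laws below agree for every \<open>n\<close>.\<close>
  have scale: "sqrt (real n) * (1 / real n) = 1 / sqrt (real n)" for n
    by (cases "n = 0") (simp_all add: real_div_sqrt field_simps)
  have "distr M borel (\<lambda>\<omega>. ((1 / sqrt (real n)) *\<^sub>R (\<Sum>i<n. V i \<omega>), (1 / sqrt (real n)) *\<^sub>R (\<Sum>i<n. W i \<omega>)))
    = distr M borel (\<lambda>\<omega>. (sqrt (real n) *\<^sub>R T1 n \<omega>, sqrt (real n) *\<^sub>R T2 n \<omega>))" for n
  proof (rule distr_cong_AE)
    show "AE \<omega> in M. ((1 / sqrt (real n)) *\<^sub>R (\<Sum>i<n. V i \<omega>), (1 / sqrt (real n)) *\<^sub>R (\<Sum>i<n. W i \<omega>)) = (sqrt (real n) *\<^sub>R T1 n \<omega>, sqrt (real n) *\<^sub>R T2 n \<omega>)"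
      using AE_ST[of n] by eventually_elim (simp only: T1_K K.T1_def K.T2_def V_def W_def scaleR_scaleR scale simp_thms)
  qed (simp_all add: V_def W_def)
  then have joint: "conv_in_distr (\<lambda>n. distr M borel (\<lambda>\<omega>. (sqrt (real n) *\<^sub>R T1 n \<omega>, sqrt (real n) *\<^sub>R T2 n \<omega>))) (\<mu>1 \<Otimes>\<^sub>M \<mu>2)"
    using clt by simp
  have marginals: "conv_in_distr (\<lambda>n. distr M borel (\<lambda>\<omega>. sqrt (real n) *\<^sub>R T1 n \<omega>)) \<mu>1"
    "conv_in_distr (\<lambda>n. distr M borel (\<lambda>\<omega>. sqrt (real n) *\<^sub>R T2 n \<omega>)) \<mu>2"
    by (rule conv_in_distr_marginals[OF joint]; use \<mu>1' \<mu>2' in simp)+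
  have "(\<forall>e>0. (\<lambda>n. measure M {\<omega>\<in>space M. sqrt (real n) * norm (S n \<omega> - T1 n \<omega> - T2 n \<omega>) > e}) \<longlonglongrightarrow> 0)
      \<and> (\<exists>\<mu>1 \<mu>2. centered_gaussian \<mu>1 (Gamma1 \<alpha> d \<beta>0 fX)
             \<and> centered_gaussian \<mu>2 (Gamma2 \<alpha> d \<beta>0 fX)
             \<and> conv_in_distr (\<lambda>n. distr M borel (\<lambda>\<omega>. sqrt (real n) *\<^sub>R T1 n \<omega>)) \<mu>1
             \<and> conv_in_distr (\<lambda>n. distr M borel (\<lambda>\<omega>. sqrt (real n) *\<^sub>R T2 n \<omega>)) \<mu>2
             \<and> conv_in_distr (\<lambda>n. distr M borel
                   (\<lambda>\<omega>. (sqrt (real n) *\<^sub>R T1 n \<omega>, sqrt (real n) *\<^sub>R T2 n \<omega>))) (\<mu>1 \<Otimes>\<^sub>M \<mu>2))"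
    using part1 \<mu>1 \<mu>2 marginals joint by blast
  then show ?thesis unfolding Let_def S_def T1_def T2_def .
qed

end
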